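(* Let $n\ge 1$, let $\Omega\subset\mathbb{R}$ be a bounded closed interval, and let $M:\Omega\times\mathbb{R}_+\to\mathbb{R}$ be a function such that $(x,y)\mapsto M(x,\sqrt{y})$ belongs to $C^{2}(\Omega\times\mathbb{R}_{+})$ and such that the symmetric matrix $$\begin{pmatrix} M_{xx}+\frac{M_{y}}{y} & M_{xy}\\ M_{xy} & M_{yy}\end{pmatrix}$$ is negative semidefinite at every point $(x,y)$ with $x\in\Omega$, $y>0$. Then $$\int_{\mathbb{R}^{n}} M(f,\|\nabla f\|)\,d\gamma \;\leq\; M\left(\int_{\mathbb{R}^{n}} f\,d\gamma,\,0\right)\quad\text{for all } f\in C^{\infty}(\mathbb{R}^{n};\Omega).$$
   Context: $\mathbb{R}_+=\{x\in\mathbb{R}: x\ge 0\}$. $d\gamma(x)=\frac{1}{\sqrt{(2\pi)^{n}}}e^{-|x|^{2}/2}\,dx$ is the standard Gaussian measure on $\mathbb{R}^n$. $C^{\infty}(\mathbb{R}^{n};\Omega)$ is the set of smooth functions on $\mathbb{R}^n$ with values in $\Omega$. $C^2(\Omega\times\mathbb{R}_+)$ means twice continuously differentiable up to the boundary. Subscripts denote partial derivatives of $M=M(x,y)$, and $\|\nabla f\|$ is the Euclidean norm of the gradient. *)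

theory Defs
  imports "HOL-Analysis.Analysis"
begin

text \<open>
  Derivatives are taken within \<open>S\<close>, so on a closed set with nonempty interior this is
  \<open>C\<^sup>k\<close> up to the boundary.  On such convex sets, and on the whole space, the
  derivative \<open>f'\<close> is unique.
\<close>

fun Ck_on :: "nat \<Rightarrow> 'a::euclidean_space set \<Rightarrow> ('a \<Rightarrow> real) \<Rightarrow> bool" where
  "Ck_on 0 S f \<longleftrightarrow> continuous_on S f"
| "Ck_on (Suc k) S f \<longleftrightarrow>
     (\<exists>f'. (\<forall>p\<in>S. (f has_derivative f' p) (at p within S)) \<and>
           (\<forall>v. Ck_on k S (\<lambda>p. f' p v)))"

definition smooth :: "('a::euclidean_space \<Rightarrow> real) \<Rightarrow> bool" where
  "smooth f \<longleftrightarrow> (\<forall>k. Ck_on k UNIV f)"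

definition gradient :: "(real ^ 'n \<Rightarrow> real) \<Rightarrow> real ^ 'n \<Rightarrow> real ^ 'n" where
  "gradient f x = (\<chi> i. frechet_derivative f (at x) (axis i 1))"

definition std_gaussian :: "(real ^ 'n) measure" where
  "std_gaussian = density lborel
     (\<lambda>x. ennreal (1 / sqrt ((2 * pi) ^ CARD('n)) * exp (- (norm x)\<^sup>2 / 2)))"

text \<open>
  The integral of a real function with values in \<open>[-\<infinity>, \<infinity>]\<close>.  Since
  \<open>\<infinity> - \<infinity> = \<infinity>\<close> in \<^typ>\<open>ereal\<close>, a finite upper bound on this integral
  includes the assertion that the positive part is integrable.
\<close>

definition ereal_integral :: "'a measure \<Rightarrow> ('a \<Rightarrow> real) \<Rightarrow> ereal" where
  "ereal_integral \<mu> g =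
     enn2ereal (\<integral>\<^sup>+x. ennreal (g x) \<partial>\<mu>) - enn2ereal (\<integral>\<^sup>+x. ennreal (- g x) \<partial>\<mu>)"

lemma ereal_integral_eq_integral:
  assumes "integrable \<mu> g"
  shows "ereal_integral \<mu> g = ereal (integral\<^sup>L \<mu> g)"
proof -
  have "(\<integral>\<^sup>+x. ennreal (g x) \<partial>\<mu>) \<noteq> \<infinity>" "(\<integral>\<^sup>+x. ennreal (- g x) \<partial>\<mu>) \<noteq> \<infinity>"
    using assms by (auto simp: real_integrable_def)
  then show ?thesis
    unfolding ereal_integral_def real_lebesgue_integral_def[OF assms]
    by (cases "\<integral>\<^sup>+x. ennreal (g x) \<partial>\<mu>"; cases "\<integral>\<^sup>+x. ennreal (- g x) \<partial>\<mu>")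
       (auto simp: enn2ereal_ennreal)
qed

text \<open>
  Partial derivatives of a function on \<open>\<Omega> \<times> {0..}\<close>.  The first is one-sided at the
  endpoints of the interval \<open>\<Omega>\<close>; the second is only meant for \<open>y > 0\<close>.
\<close>

definition partial_x :: "real set \<Rightarrow> (real \<Rightarrow> real \<Rightarrow> real) \<Rightarrow> real \<Rightarrow> real \<Rightarrow> real" where
  "partial_x \<Omega> F x y = vector_derivative (\<lambda>s. F s y) (at x within \<Omega>)"

definition partial_y :: "(real \<Rightarrow> real \<Rightarrow> real) \<Rightarrow> real \<Rightarrow> real \<Rightarrow> real" where
  "partial_y F x y = deriv (\<lambda>t. F x t) y"

definition negative_semidefinite :: "real ^ 'n ^ 'n \<Rightarrow> bool" where
  "negative_semidefinite A \<longleftrightarrow> transpose A = A \<and> (\<forall>v. v \<bullet> (A *v v) \<le> 0)"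

definition M_matrix :: "real set \<Rightarrow> (real \<Rightarrow> real \<Rightarrow> real) \<Rightarrow> real \<Rightarrow> real \<Rightarrow> real ^ 2 ^ 2" where
  "M_matrix \<Omega> M x y =
     (let Mx = partial_x \<Omega> M; My = partial_y M;
          Mxx = partial_x \<Omega> Mx; Mxy = partial_y Mx; Myy = partial_y My
      in vector [vector [Mxx x y + My x y / y, Mxy x y],
                 vector [Mxy x y,              Myy x y]])"

end

theory Submission
  imports Defs "HOL-Probability.Probability" "HOL-Real_Asymp.Real_Asymp"
begin

text \<open>
  Write \<open>N (x, z) = M x (sqrt z)\<close>, let \<open>Z\<close> be a standard Gaussian vector, and let \<open>v t\<close>, \<open>P t\<close> be
  the averages of \<open>f\<close> and of its gradient over \<open>x + sqrt (1 - t) *\<^sub>R Z\<close>.  The quantity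
  \<open>E (N (v t, t * (norm (P t))\<^sup>2))\<close>, evaluated at the point \<open>sqrt t *\<^sub>R Z\<close>, equals the right-hand side
  at \<open>t = 0\<close> and the left-hand side at \<open>t = 1\<close>.  A Gaussian step of length \<open>\<rho> = sqrt (1 / m)\<close>
  increases it by at most \<open>C * \<rho> ^ 3\<close>: in a Taylor expansion around the mean the linear term
  averages to zero, and the matrix condition bounds the second derivative by \<open>- 2 * Nz\<close> times
  the squared increment of \<open>v\<close>, whose mean is about \<open>\<rho>\<^sup>2 * (norm P)\<^sup>2\<close>; this is compensated by
  the increase of \<open>t\<close>.  Summing \<open>m\<close> steps and letting \<open>m\<close> tend to infinity gives the inequality
  when the gradient of \<open>f\<close> is bounded and Lipschitz.

  In general, \<open>f\<close> is replaced by \<open>f \<circ> \<phi>\<close>, where \<open>\<phi>\<close> applies \<open>t \<mapsto> k * arctan (t / k)\<close> to each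
  coordinate.  As \<open>\<phi>\<close> is a contraction and \<open>M\<close> is decreasing in \<open>y\<close>, the integrand of \<open>f \<circ> \<phi>\<close>
  dominates that of \<open>f\<close> composed with \<open>\<phi>\<close>; and the density of the image of the Gaussian measure
  under \<open>\<phi>\<close> with respect to the Gaussian measure is bounded uniformly in \<open>k\<close>, so that dominated
  convergence applies as soon as the integrand of \<open>f\<close> is integrable.
\<close>

section \<open>The standard Gaussian measure\<close>

text \<open>Both sides give a box the product over \<open>I\<close> of one-dimensional integrals,
  because the integral of a product of functions of separate coordinates factorises; boxes determine
  a finite product measure. It serves for the Gaussian density and again for the density of
  \<open>squash\<close>.\<close>

lemma PiM_density:
  fixes N :: "'a measure" and I :: "'i set"
  assumes I: "finite I" and N: "sigma_finite_measure N" "sigma_finite_measure (density N r)"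
    and r[measurable]: "r \<in> borel_measurable N"
  shows "density (PiM I (\<lambda>_. N)) (\<lambda>f. \<Prod>i\<in>I. r (f i)) = PiM I (\<lambda>_. density N r)"
proof -
  interpret N: product_sigma_finite "\<lambda>_. N" using N(1) by (simp add: product_sigma_finite_def)
  interpret D: product_sigma_finite "\<lambda>_. density N r" using N(2) by (simp add: product_sigma_finite_def)
  show ?thesis
  proof (rule D.PiM_eqI[OF I])
    show "sets (density (PiM I (\<lambda>_. N)) (\<lambda>f. \<Prod>i\<in>I. r (f i))) = sets (PiM I (\<lambda>_. density N r))"
      by (simp cong: sets_PiM_cong)
  next
    fix A assume A: "\<And>i. i \<in> I \<Longrightarrow> A i \<in> sets (density N r)"
    have A'[measurable]: "i \<in> I \<Longrightarrow> A i \<in> sets N" for i using A by simp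
    have PA: "Pi\<^sub>E I A \<in> sets (PiM I (\<lambda>_. N))" using I by (intro sets_PiM_I_finite) auto
    have "emeasure (density (PiM I (\<lambda>_. N)) (\<lambda>f. \<Prod>i\<in>I. r (f i))) (Pi\<^sub>E I A)
        = (\<integral>\<^sup>+f. (\<Prod>i\<in>I. r (f i)) * indicator (Pi\<^sub>E I A) f \<partial>PiM I (\<lambda>_. N))"
      using PA by (subst emeasure_density) auto
    also have "\<dots> = (\<integral>\<^sup>+f. (\<Prod>i\<in>I. r (f i) * indicator (A i) (f i)) \<partial>PiM I (\<lambda>_. N))"
    proof (rule nn_integral_cong)
      fix f assume f: "f \<in> space (PiM I (\<lambda>_. N))"
      have "indicator (Pi\<^sub>E I A) f = (\<Prod>i\<in>I. indicator (A i) (f i) :: ennreal)"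
      proof (cases "f \<in> Pi\<^sub>E I A")
        case True then show ?thesis by (auto simp: PiE_iff indicator_def)
      next
        case False
        then obtain i where "i \<in> I" "f i \<notin> A i" using f by (auto simp: space_PiM PiE_iff)
        then show ?thesis using False I by (auto simp: indicator_def prod_zero_iff)
      qed
      then show "(\<Prod>i\<in>I. r (f i)) * indicator (Pi\<^sub>E I A) f = (\<Prod>i\<in>I. r (f i) * indicator (A i) (f i))"
        by (simp add: prod.distrib)
    qed
    also have "\<dots> = (\<Prod>i\<in>I. \<integral>\<^sup>+x. r x * indicator (A i) x \<partial>N)"
      by (subst N.product_nn_integral_prod[OF I]) auto
    also have "\<dots> = (\<Prod>i\<in>I. emeasure (density N r) (A i))"
      by (intro prod.cong refl) (simp add: emeasure_density)
    finally show "emeasure (density (PiM I (\<lambda>_. N)) (\<lambda>f. \<Prod>i\<in>I. r (f i))) (Pi\<^sub>E I A)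
      = (\<Prod>i\<in>I. emeasure (density N r) (A i))" .
  qed
qed

section \<open>The Gaussian measure as an image of a product of one-dimensional measures\<close>

abbreviation std_normal :: "real measure" where
  "std_normal \<equiv> density lborel std_normal_density"

text \<open>The map through which \<open>lborel\<close> is an image of a product of Lebesgue
  measures on the line; coordinates are therefore indexed by \<open>Basis\<close>.\<close>

abbreviation vec_of :: "(real ^ 'n \<Rightarrow> real) \<Rightarrow> real ^ 'n" where
  "vec_of f \<equiv> \<Sum>b\<in>Basis. f b *\<^sub>R b"

lemma prob_space_std_normal: "prob_space std_normal"
  by (rule prob_space_normal_density) simp

lemma measurable_vec_of[measurable]:
  assumes "sets N = sets borel"
  shows "vec_of \<in> borel_measurable (PiM Basis (\<lambda>_. N))"
proof (intro borel_measurable_sum borel_measurable_scaleR measurable_const)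
  fix b :: "real ^ 'n" assume "b \<in> Basis"
  then show "(\<lambda>f. f b) \<in> borel_measurable (PiM Basis (\<lambda>_. N))"
    using measurable_component_singleton[of b Basis "\<lambda>_. N"] measurable_cong_sets[OF refl assms] by blast
qed simp

lemma vec_of_inner: "b \<in> Basis \<Longrightarrow> vec_of f \<bullet> b = f b"
  by (simp add: inner_sum_left inner_Basis if_distrib sum.delta cong: if_cong)

lemma std_gaussian_density_prod:
  fixes x :: "real ^ 'n"
  shows "1 / sqrt ((2 * pi) ^ CARD('n)) * exp (- (norm x)\<^sup>2 / 2) = (\<Prod>b\<in>Basis. std_normal_density (x \<bullet> b))"
proof -
  have "(\<Prod>b\<in>Basis. std_normal_density (x \<bullet> b))
      = (\<Prod>b\<in>(Basis::(real^'n) set). 1 / sqrt (2 * pi)) * (\<Prod>b\<in>Basis. exp (- (x \<bullet> b)\<^sup>2 / 2))"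
    by (subst prod.distrib[symmetric]) (simp add: std_normal_density_def)
  also have "(\<Prod>b\<in>Basis. exp (- (x \<bullet> b)\<^sup>2 / 2)) = exp (- (norm x)\<^sup>2 / 2)"
  proof -
    have "(norm x)\<^sup>2 = (\<Sum>b\<in>Basis. (x \<bullet> b)\<^sup>2)"
      by (subst power2_norm_eq_inner, subst euclidean_inner) (simp add: power2_eq_square)
    then show ?thesis by (simp add: exp_sum[symmetric] sum_divide_distrib[symmetric] sum_negf)
  qed
  also have "(\<Prod>b\<in>(Basis::(real^'n) set). 1 / sqrt (2 * pi)) = 1 / sqrt ((2 * pi) ^ CARD('n))"
    by (simp only: prod_constant power_divide real_sqrt_power) (simp add: DIM_cart)
  finally show ?thesis by simp
qed

text \<open>The density factorises over the coordinates, so it can be pulled back through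
  \<open>vec_of\<close> and then distributed over the factors by \<open>PiM_density\<close>.\<close>

lemma std_gaussian_eq_distr_PiM:
  "(std_gaussian :: (real ^ 'n) measure) = distr (PiM Basis (\<lambda>_. std_normal)) borel vec_of"
proof -
  interpret prob_space std_normal by (rule prob_space_std_normal)
  have "(std_gaussian :: (real ^ 'n) measure)
      = density (distr (PiM Basis (\<lambda>_. lborel)) borel vec_of) (\<lambda>x. ennreal (\<Prod>b\<in>Basis. std_normal_density (x \<bullet> b)))"
    unfolding std_gaussian_def std_gaussian_density_prod by (simp add: lborel_eq[symmetric])
  also have "\<dots> = distr (density (PiM Basis (\<lambda>_. lborel)) (\<lambda>f. \<Prod>b\<in>Basis. ennreal (std_normal_density (f b)))) borel vec_of"
    by (subst density_distr) (auto simp: vec_of_inner prod_ennreal intro!: arg_cong[where f="\<lambda>m. distr m borel vec_of"] arg_cong2[where f=density] ext prod.cong)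
  also have "\<dots> = distr (PiM Basis (\<lambda>_. std_normal)) borel vec_of"
    by (subst PiM_density) (auto intro!: sigma_finite_lborel sigma_finite_measure)
  finally show ?thesis .
qed

lemma prob_space_std_gaussian: "prob_space std_gaussian"
proof -
  interpret prob_space std_normal by (rule prob_space_std_normal)
  interpret P: product_prob_space "\<lambda>_. std_normal" Basis by standard
  show ?thesis unfolding std_gaussian_eq_distr_PiM
    by (rule P.prob_space_distr) measurable
qed

lemma sets_std_gaussian[simp, measurable_cong]: "sets std_gaussian = sets borel"
  by (simp add: std_gaussian_def)

lemma space_std_gaussian[simp]: "space std_gaussian = UNIV"
  by (simp add: std_gaussian_def)

interpretation std_gaussian: prob_space std_gaussian
  by (rule prob_space_std_gaussian)

lemma measure_std_gaussian_UNIV[simp]: "measure std_gaussian UNIV = 1"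
  using std_gaussian.prob_space by simp

section \<open>Moments of the Gaussian measure\<close>

lemma integrable_std_normal_power: "integrable std_normal (\<lambda>x. x ^ k)"
  by (subst integrable_real_density) (auto simp: integrable_std_normal_moment)

text \<open>Independence of the coordinates: under the product measure both claims are Fubini's
  theorem for a product of functions of separate variables.\<close>

lemma std_gaussian_coord:
  fixes f :: "real ^ 'n \<Rightarrow> real \<Rightarrow> real"
  assumes f: "\<And>b. b \<in> Basis \<Longrightarrow> integrable std_normal (f b)"
  shows "integrable std_gaussian (\<lambda>x. \<Prod>b\<in>Basis. f b (x \<bullet> b))"
    "(\<integral>x. (\<Prod>b\<in>Basis. f b (x \<bullet> b)) \<partial>std_gaussian) = (\<Prod>b\<in>Basis. integral\<^sup>L std_normal (f b))"
proof -
  interpret prob_space std_normal by (rule prob_space_std_normal)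
  interpret product_sigma_finite "\<lambda>_. std_normal" by standard
  have [measurable]: "b \<in> Basis \<Longrightarrow> f b \<in> borel_measurable borel" for b
    using f[of b] by (auto dest: borel_measurable_integrable)
  have *: "(\<lambda>x::real^'n. \<Prod>b\<in>Basis. f b (x \<bullet> b)) \<in> borel_measurable borel"
    by measurable
  have eq: "(\<Prod>b\<in>Basis. f b (vec_of g \<bullet> b)) = (\<Prod>b\<in>Basis. f b (g b))" for g
    by (intro prod.cong refl) (simp add: vec_of_inner)
  show "integrable std_gaussian (\<lambda>x. \<Prod>b\<in>Basis. f b (x \<bullet> b))"
    unfolding std_gaussian_eq_distr_PiM using * f
    by (subst integrable_distr_eq) (auto simp: eq intro!: product_integrable_prod)
  show "(\<integral>x. (\<Prod>b\<in>Basis. f b (x \<bullet> b)) \<partial>std_gaussian) = (\<Prod>b\<in>Basis. integral\<^sup>L std_normal (f b))"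
    unfolding std_gaussian_eq_distr_PiM using * f
    by (subst integral_distr) (auto simp: eq intro!: product_integral_prod)
qed

lemma std_normal_moments:
  "(\<integral>x. x \<partial>std_normal) = 0" "(\<integral>x. x\<^sup>2 \<partial>std_normal) = 1"
  using std_normal_moment_odd[of 0] std_normal_moment_even[of 1]
  by (auto simp: integral_density has_bochner_integral_integral_eq fact_numeral)

lemma std_gaussian_coord_single:
  fixes g :: "real \<Rightarrow> real" and c :: "real ^ 'n"
  assumes g: "integrable std_normal g" and c: "c \<in> Basis"
  shows "integrable std_gaussian (\<lambda>x. g (x \<bullet> c))"
    "(\<integral>x. g (x \<bullet> c) \<partial>std_gaussian) = integral\<^sup>L std_normal g"
proof -
  interpret N: prob_space std_normal by (rule prob_space_std_normal)
  have *: "(\<Prod>b\<in>Basis. (if b = c then g (h b) else 1)) = g (h c)" for h :: "real^'n \<Rightarrow> real"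
    using c by (simp add: prod.delta)
  have I: "integrable std_normal (\<lambda>t. if b = c then g t else 1)" for b
    using g by (cases "b = c") auto
  have "(\<lambda>x. \<Prod>b\<in>Basis. (if b = c then g (x \<bullet> b) else 1)) = (\<lambda>x. g (x \<bullet> c))"
    using * by auto
  then show "integrable std_gaussian (\<lambda>x. g (x \<bullet> c))"
    using std_gaussian_coord(1)[where f="\<lambda>b t. if b = c then g t else 1", OF I] by simp
  have "(\<Prod>b\<in>Basis. (\<integral>t. (if b = c then g t else 1) \<partial>std_normal)) = (\<Prod>b\<in>Basis. (if b = c then integral\<^sup>L std_normal g else 1))"
    using N.prob_space by (intro prod.cong refl) auto
  then show "(\<integral>x. g (x \<bullet> c) \<partial>std_gaussian) = integral\<^sup>L std_normal g"
    using std_gaussian_coord(2)[where f="\<lambda>b t. if b = c then g t else 1", OF I] c * by simp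
qed

lemma std_gaussian_covariance:
  fixes c d :: "real ^ 'n"
  assumes c: "c \<in> Basis" and d: "d \<in> Basis"
  shows "integrable std_gaussian (\<lambda>x. (x \<bullet> c) * (x \<bullet> d))"
    "(\<integral>x. (x \<bullet> c) * (x \<bullet> d) \<partial>std_gaussian) = (if c = d then 1 else 0)"
proof -
  interpret N: prob_space std_normal by (rule prob_space_std_normal)
  have "integrable std_gaussian (\<lambda>x. (x \<bullet> c) * (x \<bullet> d)) \<and>
    (\<integral>x. (x \<bullet> c) * (x \<bullet> d) \<partial>std_gaussian) = (if c = d then 1 else 0)"
  proof (cases "c = d")
    case True
    then show ?thesis
      using std_gaussian_coord_single[OF integrable_std_normal_power[of 2] d] std_normal_moments
      by (simp add: power2_eq_square)
  next
    case False
    \<comment> \<open>The variable is put into the coordinates \<open>c\<close> and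
      \<open>d\<close>, and 1 into all others. Since \<open>c\<close> and \<open>d\<close> differ,
      the factor at \<open>c\<close> is a first moment, which vanishes.\<close>
    define f where "f = (\<lambda>b t::real. (if b = c then t else 1) * (if b = d then t else 1))"
    have I: "integrable std_normal (f b)" for b
      using integrable_std_normal_power[of 1] integrable_std_normal_power[of 2]
      by (cases "b = c"; cases "b = d") (auto simp: f_def power2_eq_square)
    have f: "(\<Prod>b\<in>Basis. f b (x \<bullet> b)) = (x \<bullet> c) * (x \<bullet> d)" for x
      using c d by (simp add: f_def prod.distrib prod.delta)
    have "integral\<^sup>L std_normal (f c) = 0" using False std_normal_moments(1) by (simp add: f_def)
    then have "(\<Prod>b\<in>Basis. integral\<^sup>L std_normal (f b)) = 0"
      using c by (intro prod_zero) auto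
    then show ?thesis using std_gaussian_coord[of f, OF I] False by (simp add: f)
  qed
  then show "integrable std_gaussian (\<lambda>x. (x \<bullet> c) * (x \<bullet> d))"
    "(\<integral>x. (x \<bullet> c) * (x \<bullet> d) \<partial>std_gaussian) = (if c = d then 1 else 0)" by auto
qed

lemma std_gaussian_inner_square:
  fixes p :: "real ^ 'n"
  shows "integrable std_gaussian (\<lambda>x. (p \<bullet> x)\<^sup>2)" "(\<integral>x. (p \<bullet> x)\<^sup>2 \<partial>std_gaussian) = (norm p)\<^sup>2"
proof -
  have eq: "(p \<bullet> x)\<^sup>2 = (\<Sum>c\<in>Basis. \<Sum>d\<in>Basis. (p \<bullet> c) * (p \<bullet> d) * ((x \<bullet> c) * (x \<bullet> d)))" for x
    by (simp add: euclidean_inner[of p x] power2_eq_square sum_product mult_ac)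
  show "integrable std_gaussian (\<lambda>x. (p \<bullet> x)\<^sup>2)"
    unfolding eq by (intro Bochner_Integration.integrable_sum integrable_mult_right std_gaussian_covariance)
  have "(\<integral>x. (p \<bullet> x)\<^sup>2 \<partial>std_gaussian)
      = (\<Sum>c\<in>Basis. \<Sum>d\<in>Basis. (p \<bullet> c) * (p \<bullet> d) * (\<integral>x. (x \<bullet> c) * (x \<bullet> d) \<partial>std_gaussian))"
    unfolding eq by (simp add: Bochner_Integration.integral_sum std_gaussian_covariance(1)
       Bochner_Integration.integrable_sum integrable_mult_right)
  also have "\<dots> = (\<Sum>c\<in>Basis. (p \<bullet> c) * (p \<bullet> c))"
    by (intro sum.cong refl) (simp add: std_gaussian_covariance if_distrib sum.delta cong: if_cong)
  also have "\<dots> = (norm p)\<^sup>2" by (simp add: power2_norm_eq_inner euclidean_inner[of p p])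
  finally show "(\<integral>x. (p \<bullet> x)\<^sup>2 \<partial>std_gaussian) = (norm p)\<^sup>2" .
qed

text \<open>The power is at most \<open>1 + norm x ^ 4\<close>, and by Cauchy-Schwarz
  \<open>norm x ^ 4\<close> is at most the dimension times the sum of the fourth powers of the
  coordinates. The exponent 4 is the largest one that the error terms of a Gaussian step
  produce.\<close>

lemma integrable_std_gaussian_norm_power:
  assumes "k \<le> 4"
  shows "integrable std_gaussian (\<lambda>x :: real ^ 'n. norm x ^ k)"
proof (rule Bochner_Integration.integrable_bound)
  let ?D = "real DIM(real^'n)"
  show "integrable std_gaussian (\<lambda>x :: real ^ 'n. 1 + ?D * (\<Sum>b\<in>Basis. (x \<bullet> b) ^ 4))"
    by (intro Bochner_Integration.integrable_add integrable_mult_right Bochner_Integration.integrable_sum)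
       (auto intro!: std_gaussian_coord_single integrable_std_normal_power)
  show "AE x :: real ^ 'n in std_gaussian. norm (norm x ^ k) \<le> norm (1 + ?D * (\<Sum>b\<in>Basis. (x \<bullet> b) ^ 4))"
  proof (rule AE_I2)
    fix x :: "real ^ 'n"
    have "norm x ^ k \<le> 1 + norm x ^ 4"
    proof (cases "norm x \<le> 1")
      case True then have "norm x ^ k \<le> 1" by (simp add: power_le_one)
      then show ?thesis by (simp add: add_increasing2)
    next
      case False
      then have "norm x ^ k \<le> norm x ^ 4" using power_increasing[of k 4 "norm x"] assms by simp
      then show ?thesis by linarith
    qed
    also have "norm x ^ 4 = (\<Sum>b\<in>Basis. (x \<bullet> b)\<^sup>2)\<^sup>2"
    proof -
      have "(norm x)\<^sup>2 = (\<Sum>b\<in>Basis. (x \<bullet> b)\<^sup>2)"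
        by (subst power2_norm_eq_inner, subst euclidean_inner) (simp add: power2_eq_square)
      then show ?thesis by (metis power2_eq_square power4_eq_xxxx mult.assoc)
    qed
    also have "\<dots> \<le> ?D * (\<Sum>b\<in>Basis. (x \<bullet> b) ^ 4)"
      using sum_squared_le_sum_of_squares[of "\<lambda>b. (x \<bullet> b)\<^sup>2" Basis]
      by (simp add: mult.commute flip: power_mult)
    finally show "norm (norm x ^ k) \<le> norm (1 + ?D * (\<Sum>b\<in>Basis. (x \<bullet> b) ^ 4))" by simp
  qed
qed auto

section \<open>Rotation invariance and the semigroup of Gaussian averages\<close>

lemma nn_integral_lborel_affine:
  fixes h :: "'a::euclidean_space \<Rightarrow> ennreal"
  assumes [measurable]: "h \<in> borel_measurable borel" and c: "c \<noteq> 0"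
  shows "(\<integral>\<^sup>+x. h x \<partial>lborel) = ennreal (\<bar>c\<bar> ^ DIM('a)) * (\<integral>\<^sup>+x. h (t + c *\<^sub>R x) \<partial>lborel)"
  by (subst lborel_affine[OF c, of t])
     (simp add: nn_integral_density nn_integral_distr nn_integral_cmult)


text \<open>In the variables \<open>z\<close> and \<open>u = c *\<^sub>R z + d *\<^sub>R w\<close>
  the joint density is symmetric. After Tonelli's theorem it therefore splits into the density of
  \<open>u\<close> and a density in \<open>z\<close> of total mass one.\<close>

lemma std_gaussian_nn_convolution:
  fixes h :: "real ^ 'n \<Rightarrow> ennreal"
  assumes [measurable]: "h \<in> borel_measurable borel" and d: "d \<noteq> 0" and cd: "c\<^sup>2 + d\<^sup>2 = 1"
  shows "(\<integral>\<^sup>+z. \<integral>\<^sup>+w. h (c *\<^sub>R z + d *\<^sub>R w) \<partial>std_gaussian \<partial>std_gaussian) = (\<integral>\<^sup>+u. h u \<partial>std_gaussian)"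
proof -
  define \<phi> :: "real ^ 'n \<Rightarrow> ennreal"
    where "\<phi> x = ennreal (1 / sqrt ((2 * pi) ^ CARD('n)) * exp (- (norm x)\<^sup>2 / 2))" for x
  \<comment> \<open>The Jacobian factor of the substitution
    \<open>w = (1 / d) *\<^sub>R (u - c *\<^sub>R z)\<close>.\<close>
  define k where "k = ennreal (\<bar>1 / d\<bar> ^ CARD('n))"
  have [measurable]: "\<phi> \<in> borel_measurable borel" unfolding \<phi>_def by measurable
  have \<gamma>: "std_gaussian = density lborel \<phi>" unfolding std_gaussian_def \<phi>_def ..
  have total: "k * (\<integral>\<^sup>+z. \<phi> ((1 / d) *\<^sub>R (z - c *\<^sub>R u)) \<partial>lborel) = 1" for u
  proof -
    have "(\<integral>\<^sup>+z. \<phi> z \<partial>lborel) = 1"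
      using std_gaussian.emeasure_space_1[where 'a='n] by (simp add: \<gamma> emeasure_density)
    then show ?thesis
      using nn_integral_lborel_affine[of \<phi> "1/d" "- (c / d) *\<^sub>R u"] d
      by (simp add: k_def scaleR_diff_right algebra_simps)
  qed
  \<comment> \<open>The symmetry of the joint density in \<open>z\<close> and \<open>u\<close>; the
    two exponents agree because \<open>c\<^sup>2 + d\<^sup>2 = 1\<close>.\<close>
  have swap: "\<phi> z * \<phi> ((1 / d) *\<^sub>R (u - c *\<^sub>R z)) = \<phi> u * \<phi> ((1 / d) *\<^sub>R (z - c *\<^sub>R u))" for u z
  proof -
    have "(norm z)\<^sup>2 + (norm ((1 / d) *\<^sub>R (u - c *\<^sub>R z)))\<^sup>2 = ((d\<^sup>2 + c\<^sup>2) * (norm z)\<^sup>2 + (norm u)\<^sup>2 - 2 * c * (u \<bullet> z)) / d\<^sup>2"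
      using d unfolding power2_norm_eq_inner
      by (simp add: inner_diff_left inner_diff_right inner_commute field_simps power2_eq_square)
    moreover have "(norm u)\<^sup>2 + (norm ((1 / d) *\<^sub>R (z - c *\<^sub>R u)))\<^sup>2 = ((d\<^sup>2 + c\<^sup>2) * (norm u)\<^sup>2 + (norm z)\<^sup>2 - 2 * c * (u \<bullet> z)) / d\<^sup>2"
      using d unfolding power2_norm_eq_inner
      by (simp add: inner_diff_left inner_diff_right inner_commute field_simps power2_eq_square)
    ultimately have "(norm z)\<^sup>2 + (norm ((1 / d) *\<^sub>R (u - c *\<^sub>R z)))\<^sup>2 = (norm u)\<^sup>2 + (norm ((1 / d) *\<^sub>R (z - c *\<^sub>R u)))\<^sup>2"
      using cd by (simp add: add.commute)
    then have "exp (- (norm z)\<^sup>2 / 2) * exp (- (norm ((1 / d) *\<^sub>R (u - c *\<^sub>R z)))\<^sup>2 / 2)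
       = exp (- (norm u)\<^sup>2 / 2) * exp (- (norm ((1 / d) *\<^sub>R (z - c *\<^sub>R u)))\<^sup>2 / 2)"
      unfolding exp_add[symmetric] by (intro arg_cong[where f=exp]) argo
    then show ?thesis unfolding \<phi>_def by (simp add: ennreal_mult'[symmetric])
  qed
  have "(\<integral>\<^sup>+z. \<integral>\<^sup>+w. h (c *\<^sub>R z + d *\<^sub>R w) \<partial>std_gaussian \<partial>std_gaussian)
      = (\<integral>\<^sup>+z. \<phi> z * (\<integral>\<^sup>+w. \<phi> w * h (c *\<^sub>R z + d *\<^sub>R w) \<partial>lborel) \<partial>lborel)"
    unfolding \<gamma> by (simp add: nn_integral_density)
  also have "\<dots> = (\<integral>\<^sup>+z. \<integral>\<^sup>+u. k * (\<phi> z * \<phi> ((1 / d) *\<^sub>R (u - c *\<^sub>R z)) * h u) \<partial>lborel \<partial>lborel)"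
  proof (intro nn_integral_cong)
    fix z
    have "(\<integral>\<^sup>+w. \<phi> w * h (c *\<^sub>R z + d *\<^sub>R w) \<partial>lborel) = k * (\<integral>\<^sup>+u. \<phi> ((1 / d) *\<^sub>R (u - c *\<^sub>R z)) * h u \<partial>lborel)"
      using nn_integral_lborel_affine[of "\<lambda>w. \<phi> w * h (c *\<^sub>R z + d *\<^sub>R w)" "1/d" "- (c / d) *\<^sub>R z"] d
      by (simp add: k_def scaleR_diff_right scaleR_add_right algebra_simps)
    then show "\<phi> z * (\<integral>\<^sup>+w. \<phi> w * h (c *\<^sub>R z + d *\<^sub>R w) \<partial>lborel)
       = (\<integral>\<^sup>+u. k * (\<phi> z * \<phi> ((1 / d) *\<^sub>R (u - c *\<^sub>R z)) * h u) \<partial>lborel)"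
      by (simp add: nn_integral_cmult mult.assoc) (simp add: mult.left_commute)
  qed
  also have "\<dots> = (\<integral>\<^sup>+u. \<integral>\<^sup>+z. k * (\<phi> z * \<phi> ((1 / d) *\<^sub>R (u - c *\<^sub>R z)) * h u) \<partial>lborel \<partial>lborel)"
    by (rule lborel_pair.Fubini') measurable
  also have "\<dots> = (\<integral>\<^sup>+u. (\<phi> u * h u) * (k * (\<integral>\<^sup>+z. \<phi> ((1 / d) *\<^sub>R (z - c *\<^sub>R u)) \<partial>lborel)) \<partial>lborel)"
    unfolding swap by (subst nn_integral_cmult[symmetric], measurable)+ (intro nn_integral_cong, simp add: mult_ac)
  also have "\<dots> = (\<integral>\<^sup>+u. h u \<partial>std_gaussian)" unfolding total \<gamma> by (simp add: nn_integral_density)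
  finally show ?thesis .
qed

lemma std_gaussian_convolution:
  fixes c d :: real
  assumes d: "d \<noteq> 0" and cd: "c\<^sup>2 + d\<^sup>2 = 1"
  shows "distr (std_gaussian \<Otimes>\<^sub>M std_gaussian) borel (\<lambda>(z, w). c *\<^sub>R z + d *\<^sub>R w) = (std_gaussian :: (real ^ 'n) measure)"
proof (rule measure_eqI)
  fix A assume "A \<in> sets (distr (std_gaussian \<Otimes>\<^sub>M std_gaussian) borel (\<lambda>(z, w). c *\<^sub>R z + d *\<^sub>R w :: real ^ 'n))"
  then have [measurable]: "A \<in> sets borel" by simp
  have "emeasure (distr (std_gaussian \<Otimes>\<^sub>M std_gaussian) borel (\<lambda>(z, w). c *\<^sub>R z + d *\<^sub>R w)) A
      = (\<integral>\<^sup>+p. indicator A (case p of (z, w) \<Rightarrow> c *\<^sub>R z + d *\<^sub>R w) \<partial>(std_gaussian \<Otimes>\<^sub>M std_gaussian))"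
    by (subst nn_integral_indicator[symmetric], simp) (subst nn_integral_distr, auto)
  also have "\<dots> = (\<integral>\<^sup>+z. \<integral>\<^sup>+w. indicator A (c *\<^sub>R z + d *\<^sub>R w) \<partial>std_gaussian \<partial>std_gaussian)"
    by (subst std_gaussian.nn_integral_fst[symmetric]) (auto simp: measurable_split_conv)
  also have "\<dots> = emeasure std_gaussian A"
    by (subst std_gaussian_nn_convolution[OF _ d cd]) auto
  finally show "emeasure (distr (std_gaussian \<Otimes>\<^sub>M std_gaussian) borel (\<lambda>(z, w). c *\<^sub>R z + d *\<^sub>R w)) A = emeasure std_gaussian A" .
qed simp

text \<open>The heat semigroup at time \<open>r\<^sup>2 / 2\<close>, parametrised by the standard
  deviation. Vector values are allowed because gradients are averaged as well.\<close>

definition gauss_avg :: "real \<Rightarrow> (real ^ 'n \<Rightarrow> 'b::{banach, second_countable_topology}) \<Rightarrow> real ^ 'n \<Rightarrow> 'b" where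
  "gauss_avg r g x = (\<integral>z. g (x + r *\<^sub>R z) \<partial>std_gaussian)"

lemma integrable_std_gaussian_bounded:
  fixes g :: "real ^ 'n \<Rightarrow> 'b::{banach, second_countable_topology}"
  assumes "g \<in> borel_measurable borel" "\<And>x. norm (g x) \<le> B"
  shows "integrable std_gaussian g"
  using assms by (intro std_gaussian.integrable_const_bound[where B=B]) auto

text \<open>Variances of independent Gaussian vectors add. Dividing \<open>c\<close> and
  \<open>d\<close> by \<open>r\<close> reduces this to \<open>std_gaussian_convolution\<close>, and
  Fubini's theorem separates the two averages.\<close>

lemma gauss_avg_gauss_avg_aux:
  fixes g :: "real ^ 'n \<Rightarrow> 'b::{banach, second_countable_topology}"
  assumes g[measurable]: "g \<in> borel_measurable borel" and B: "\<And>x. norm (g x) \<le> B"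
    and d: "d \<noteq> 0" and r: "r\<^sup>2 = c\<^sup>2 + d\<^sup>2"
  shows "gauss_avg c (gauss_avg d g) x = gauss_avg r g x"
proof -
  interpret P: pair_prob_space "std_gaussian :: (real^'n) measure" "std_gaussian :: (real^'n) measure" ..
  have r0: "r \<noteq> 0" using r d by (metis power_zero_numeral sum_power2_eq_zero_iff)
  have cd: "(c / r)\<^sup>2 + (d / r)\<^sup>2 = 1" using r0 by (simp only: power_divide add_divide_distrib[symmetric] r[symmetric]) simp
  have "gauss_avg r g x = (\<integral>u. g (x + r *\<^sub>R u) \<partial>distr (std_gaussian \<Otimes>\<^sub>M std_gaussian) borel (\<lambda>(z, w). (c / r) *\<^sub>R z + (d / r) *\<^sub>R w))"
    unfolding gauss_avg_def using std_gaussian_convolution[where 'n='n, OF _ cd] d r0 by simp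
  also have "\<dots> = (\<integral>p. g (x + c *\<^sub>R fst p + d *\<^sub>R snd p) \<partial>(std_gaussian \<Otimes>\<^sub>M std_gaussian))"
    using r0 by (subst integral_distr) (auto simp: split_beta scaleR_add_right add.assoc)
  also have "\<dots> = (\<integral>z. \<integral>w. g (x + c *\<^sub>R z + d *\<^sub>R w) \<partial>std_gaussian \<partial>std_gaussian)"
    by (subst P.integral_fst'[symmetric]) (auto intro!: P.integrable_const_bound[where B=B] B)
  finally show ?thesis by (simp add: gauss_avg_def)
qed

lemma gauss_avg_0[simp]: "gauss_avg 0 g = g"
  by (rule ext) (simp add: gauss_avg_def)

text \<open>Adds the case \<open>d = 0\<close>, where the inner average is trivial and the signs of
  \<open>c\<close> and \<open>r\<close> turn the equality of squares into
  \<open>r = c\<close>.\<close>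

lemma gauss_avg_gauss_avg:
  fixes g :: "real ^ 'n \<Rightarrow> 'b::{banach, second_countable_topology}"
  assumes "g \<in> borel_measurable borel" "\<And>x. norm (g x) \<le> B"
    and "0 \<le> c" "0 \<le> r" and r: "r\<^sup>2 = c\<^sup>2 + d\<^sup>2"
  shows "gauss_avg c (gauss_avg d g) x = gauss_avg r g x"
proof (cases "d = 0")
  case True
  then have "r = c" using assms by (simp add: power2_eq_iff_nonneg)
  then show ?thesis using True by simp
next
  case False
  then show ?thesis using gauss_avg_gauss_avg_aux assms by blast
qed

section \<open>Second-order estimates\<close>

text \<open>Taylor's formula with a one-sided bound on the second derivative, from two uses of the
  mean value theorem: first for \<open>\<phi>'\<close>, then for \<open>\<phi>\<close> minus the
  quadratic polynomial that is to dominate it.\<close>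

lemma second_order_upper_bound:
  fixes \<phi> :: "real \<Rightarrow> real"
  assumes d1: "\<And>t. t \<in> {0..1} \<Longrightarrow> (\<phi> has_field_derivative \<phi>' t) (at t within {0..1})"
    and d2: "\<And>t. t \<in> {0..1} \<Longrightarrow> (\<phi>' has_field_derivative \<phi>'' t) (at t within {0..1})"
    and C: "\<And>t. t \<in> {0..1} \<Longrightarrow> \<phi>'' t \<le> 2 * C"
  shows "\<phi> 1 \<le> \<phi> 0 + \<phi>' 0 + C"
proof -
  have A: "\<phi>' t \<le> \<phi>' 0 + 2 * C * t" if "t \<in> {0..1}" for t
  proof (cases "t = 0")
    case False
    then have t: "0 < t" "t \<le> 1" using that by auto
    have "\<exists>x\<in>{0<..<t}. \<phi>' t - \<phi>' 0 = \<phi>'' x * (t - 0)"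
      using t by (intro mvt_simple) (auto intro!: has_field_derivative_subset[OF d2, THEN has_field_derivative_imp_has_derivative])
    then obtain x where x: "x \<in> {0<..<t}" "\<phi>' t - \<phi>' 0 = \<phi>'' x * t" by auto
    have "\<phi>'' x * t \<le> 2 * C * t" using C[of x] x t by (intro mult_right_mono) auto
    with x(2) show ?thesis by linarith
  qed simp
  define \<psi> where "\<psi> t = \<phi> t - \<phi>' 0 * t - C * t\<^sup>2" for t
  have "\<exists>x\<in>{0<..<1}. \<psi> 1 - \<psi> 0 = (\<phi>' x - \<phi>' 0 - 2 * C * x) * (1 - 0)"
    unfolding \<psi>_def
    by (intro mvt_simple) (auto intro!: derivative_eq_intros d1 has_field_derivative_imp_has_derivative simp: power2_eq_square)
  then obtain x where x: "x \<in> {0<..<1}" "\<psi> 1 - \<psi> 0 = \<phi>' x - \<phi>' 0 - 2 * C * x" by auto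
  then have "\<psi> 1 \<le> \<psi> 0" using A[of x] by auto
  then show ?thesis by (simp add: \<psi>_def)
qed

text \<open>The chain rule within a closed domain, so that curves may run along its boundary.
  Coordinate lines as curves yield the partial derivatives.\<close>

lemma has_field_derivative_along_curve:
  fixes F Fx Fz :: "real \<times> real \<Rightarrow> real" and g h :: "real \<Rightarrow> real"
  assumes F: "\<And>p. p \<in> S \<Longrightarrow>
      (F has_derivative (\<lambda>v. Fx p * fst v + Fz p * snd v)) (at p within S)"
    and g: "(g has_field_derivative g') (at t within T)" and h: "(h has_field_derivative h') (at t within T)"
    and mem: "\<And>t. t \<in> T \<Longrightarrow> (g t, h t) \<in> S" and t: "t \<in> T"
  shows "((\<lambda>t. F (g t, h t)) has_field_derivative (Fx (g t, h t) * g' + Fz (g t, h t) * h')) (at t within T)"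
proof -
  have c: "((\<lambda>t. (g t, h t)) has_derivative (\<lambda>v. (g' * v, h' * v))) (at t within T)"
    using g h unfolding has_field_derivative_def by (intro has_derivative_Pair) auto
  have im: "(\<lambda>t. (g t, h t)) ` T \<subseteq> S" using mem by auto
  have "((\<lambda>t. F (g t, h t)) has_derivative (\<lambda>v. Fx (g t, h t) * (g' * v) + Fz (g t, h t) * (h' * v))) (at t within T)"
    using has_derivative_in_compose[OF c has_derivative_subset[OF F[OF mem[OF t]] im]] by simp
  then show ?thesis
    unfolding has_field_derivative_def by (rule has_derivative_eq_rhs) (auto simp: algebra_simps)
qed

text \<open>All that the argument uses about \<open>N (x, z) = M x (sqrt z)\<close>. With
  \<open>z = y\<^sup>2\<close> the matrix has the diagonal entries \<open>Nxx + 2 * Nz\<close> and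
  \<open>2 * Nz + 4 * z * Nzz\<close> and the off-diagonal entry \<open>2 * sqrt z * Nxz\<close>, so
  \<open>form\<close> is the matrix condition extended to \<open>z = 0\<close>. The symmetry of the
  mixed derivatives is built in: \<open>Nxz\<close> occurs in the derivatives of both
  \<open>Nx\<close> and \<open>Nz\<close>.\<close>

locale concave_profile =
  fixes a b :: real and N Nx Nz Nxx Nxz Nzz :: "real \<times> real \<Rightarrow> real"
  assumes ab: "a < b"
    and dN: "\<And>p. p \<in> {a..b} \<times> {0..} \<Longrightarrow>
      (N has_derivative (\<lambda>v. Nx p * fst v + Nz p * snd v)) (at p within {a..b} \<times> {0..})"
    and dNx: "\<And>p. p \<in> {a..b} \<times> {0..} \<Longrightarrow>
      (Nx has_derivative (\<lambda>v. Nxx p * fst v + Nxz p * snd v)) (at p within {a..b} \<times> {0..})"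
    and dNz: "\<And>p. p \<in> {a..b} \<times> {0..} \<Longrightarrow>
      (Nz has_derivative (\<lambda>v. Nxz p * fst v + Nzz p * snd v)) (at p within {a..b} \<times> {0..})"
    and form: "\<And>p u w. p \<in> {a..b} \<times> {0..} \<Longrightarrow>
      (Nxx p + 2 * Nz p) * u\<^sup>2 + 4 * sqrt (snd p) * Nxz p * (u * w) + (2 * Nz p + 4 * snd p * Nzz p) * w\<^sup>2 \<le> 0"
    and Nz_nonpos: "\<And>p. p \<in> {a..b} \<times> {0..} \<Longrightarrow> Nz p \<le> 0"
    and Nz_lipschitz: "\<And>R. \<exists>K\<ge>0. \<forall>p\<in>{a..b} \<times> {0..R}. \<forall>q\<in>{a..b} \<times> {0..R}.
      \<bar>Nz p - Nz q\<bar> \<le> K * (\<bar>fst p - fst q\<bar> + \<bar>snd p - snd q\<bar>)"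
begin

lemma continuous_N: "continuous_on ({a..b} \<times> {0..}) N"
  by (rule has_derivative_continuous_on) (rule dN)

lemma z_increment:
  assumes x: "x \<in> {a..b}" and z: "0 \<le> z0" "z0 \<le> z1"
  obtains \<zeta> where "\<zeta> \<in> {z0..z1}" "N (x, z1) - N (x, z0) = (z1 - z0) * Nz (x, \<zeta>)"
proof (cases "z0 = z1")
  case False
  then have "z0 < z1" using z by simp
  have "\<exists>\<zeta>\<in>{z0<..<z1}. N (x, z1) - N (x, z0) = (\<lambda>v. Nz (x, \<zeta>) * v) (z1 - z0)"
  proof (rule mvt_simple[OF \<open>z0 < z1\<close>])
    fix \<zeta> assume \<zeta>: "z0 \<le> \<zeta>" "\<zeta> \<le> z1"
    have "((\<lambda>z. N (x, z)) has_field_derivative (Nx (x, \<zeta>) * 0 + Nz (x, \<zeta>) * 1)) (at \<zeta> within {z0..z1})"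
      using x z \<zeta> by (intro has_field_derivative_along_curve[OF dN]) (auto intro!: derivative_eq_intros)
    then show "((\<lambda>z. N (x, z)) has_derivative (*) (Nz (x, \<zeta>))) (at \<zeta> within {z0..z1})"
      by (simp add: has_field_derivative_def)
  qed
  then obtain \<zeta> where "\<zeta> \<in> {z0<..<z1}" "N (x, z1) - N (x, z0) = Nz (x, \<zeta>) * (z1 - z0)" by auto
  then show ?thesis using that[of \<zeta>] by (auto simp: mult.commute)
qed (use that[of z0] in auto)

lemma N_antimono:
  assumes "x \<in> {a..b}" "0 \<le> z0" "z0 \<le> z1"
  shows "N (x, z1) \<le> N (x, z0)"
proof -
  obtain \<zeta> where "\<zeta> \<in> {z0..z1}" "N (x, z1) - N (x, z0) = (z1 - z0) * Nz (x, \<zeta>)"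
    using z_increment assms by blast
  moreover have "Nz (x, \<zeta>) \<le> 0" using assms calculation(1) by (intro Nz_nonpos) auto
  ultimately show ?thesis using mult_nonneg_nonpos[of "z1 - z0" "Nz (x, \<zeta>)"] assms by linarith
qed

text \<open>Along a segment in \<open>(x, v)\<close>-space the matrix condition, applied to the component of the
  increment in the direction of the current \<open>v\<close>, bounds the second derivative of
  \<open>N (x, s * (norm v)\<^sup>2)\<close> by \<open>- 2 * Nz * (\<Delta>x)\<^sup>2\<close>, whatever the increment of \<open>v\<close> is.\<close>

lemma segment_bound:
  fixes v0 v1 :: "'e::real_inner"
  assumes x: "x0 \<in> {a..b}" "x1 \<in> {a..b}" and s: "0 \<le> s" "s \<le> 1"
    and L: "norm v0 \<le> L" "norm v1 \<le> L"
    and K0: "K \<ge> 0" and K: "\<And>p q. p \<in> {a..b} \<times> {0..L\<^sup>2} \<Longrightarrow> q \<in> {a..b} \<times> {0..L\<^sup>2} \<Longrightarrow>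
      \<bar>Nz p - Nz q\<bar> \<le> K * (\<bar>fst p - fst q\<bar> + \<bar>snd p - snd q\<bar>)"
  defines "p0 \<equiv> (x0, s * (norm v0)\<^sup>2)"
  shows "N (x1, s * (norm v1)\<^sup>2) \<le> N p0 + (Nx p0 * (x1 - x0) + Nz p0 * (2 * s * (v0 \<bullet> (v1 - v0))))
     + (- Nz p0 + K * (\<bar>x1 - x0\<bar> + 2 * L * norm (v1 - v0))) * (x1 - x0)\<^sup>2"
proof -
  define \<xi> \<eta> where "\<xi> = x1 - x0" and "\<eta> = v1 - v0"
  define v where "v t = v0 + t *\<^sub>R \<eta>" for t
  define g h where "g t = x0 + t * \<xi>" and "h t = s * (norm (v t))\<^sup>2" for t
  define h1 where "h1 t = 2 * s * (v t \<bullet> \<eta>)" for t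
  define D where "D = - Nz p0 + K * (\<bar>\<xi>\<bar> + 2 * L * norm \<eta>)"
  have L0: "0 \<le> L" using L(1) norm_ge_zero order_trans by blast
  have v_conv: "v t = (1 - t) *\<^sub>R v0 + t *\<^sub>R v1" for t
    by (simp add: v_def \<eta>_def algebra_simps)
  have vL: "norm (v t) \<le> L" if "t \<in> {0..1}" for t
  proof -
    have "norm (v t) \<le> (1 - t) * norm v0 + t * norm v1"
      unfolding v_conv using that norm_triangle_ineq[of "(1 - t) *\<^sub>R v0" "t *\<^sub>R v1"] by simp
    also have "\<dots> \<le> L" using that L by (intro convex_bound_le) auto
    finally show ?thesis .
  qed
  have gx: "g t \<in> {a..b}" if "t \<in> {0..1}" for t
  proof -
    have "g t = (1 - t) *\<^sub>R x0 + t *\<^sub>R x1" by (simp add: g_def \<xi>_def algebra_simps)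
    then show ?thesis using convexD_alt[of "{a..b}" x0 x1 t] x that by simp
  qed
  have hx: "0 \<le> h t" for t using s by (simp add: h_def)
  have S: "(g t, h t) \<in> {a..b} \<times> {0..}" if "t \<in> {0..1}" for t using gx[OF that] hx by simp
  have hL: "h t \<le> L\<^sup>2" if "t \<in> {0..1}" for t
  proof -
    have "h t \<le> 1 * L\<^sup>2" unfolding h_def using s vL[OF that] by (intro mult_mono power_mono) auto
    then show ?thesis by simp
  qed
  have dg: "(g has_field_derivative \<xi>) (at t within {0..1})" for t
    unfolding g_def by (auto intro!: derivative_eq_intros)
  \<comment> \<open>As a quadratic polynomial in \<open>t\<close>, \<open>h\<close> is seen to be
    differentiable also where \<open>v t\<close> vanishes.\<close>
  have h_eq: "h = (\<lambda>t. s * (v0 \<bullet> v0 + 2 * t * (v0 \<bullet> \<eta>) + t\<^sup>2 * (\<eta> \<bullet> \<eta>)))"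
    unfolding h_def power2_norm_eq_inner
    by (rule ext) (simp add: v_def inner_add_left inner_add_right inner_commute power2_eq_square algebra_simps)
  have dh: "(h has_field_derivative h1 t) (at t within {0..1})" for t
    unfolding h_eq h1_def v_def by (auto intro!: derivative_eq_intros simp: inner_add_left algebra_simps)
  have dh1: "(h1 has_field_derivative 2 * s * (\<eta> \<bullet> \<eta>)) (at t within {0..1})" for t
    unfolding h1_def v_def inner_add_left by (auto intro!: derivative_eq_intros)
  have d1: "((\<lambda>t. N (g t, h t)) has_field_derivative (Nx (g t, h t) * \<xi> + Nz (g t, h t) * h1 t)) (at t within {0..1})"
    if "t \<in> {0..1}" for t using that by (intro has_field_derivative_along_curve[OF dN dg dh S])
  have d2: "((\<lambda>t. Nx (g t, h t) * \<xi> + Nz (g t, h t) * h1 t) has_field_derivative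
      ((Nxx (g t, h t) * \<xi> + Nxz (g t, h t) * h1 t) * \<xi> + ((Nxz (g t, h t) * \<xi> + Nzz (g t, h t) * h1 t) * h1 t
        + Nz (g t, h t) * (2 * s * (\<eta> \<bullet> \<eta>))))) (at t within {0..1})"
    if "t \<in> {0..1}" for t
    using that
    by (auto intro!: derivative_eq_intros has_field_derivative_along_curve[OF dNx dg dh S] has_field_derivative_along_curve[OF dNz dg dh S] dh1)
  have bound: "(Nxx (g t, h t) * \<xi> + Nxz (g t, h t) * h1 t) * \<xi> + ((Nxz (g t, h t) * \<xi> + Nzz (g t, h t) * h1 t) * h1 t
        + Nz (g t, h t) * (2 * s * (\<eta> \<bullet> \<eta>))) \<le> 2 * (D * \<xi>\<^sup>2)" if t: "t \<in> {0..1}" for t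
  proof -
    let ?p = "(g t, h t)"
    \<comment> \<open>\<open>sqrt s\<close> times the component of \<open>\<eta>\<close> along
      \<open>v t\<close>. Division by zero makes it 0 when \<open>v t = 0\<close>, in accordance
      with \<open>h1 t = 0\<close>.\<close>
    define w where "w = sqrt s * (v t \<bullet> \<eta>) / norm (v t)"
    have hw: "h1 t = 2 * sqrt (h t) * w"
      using s by (cases "v t = 0") (auto simp: h1_def h_def w_def real_sqrt_mult)
    have "w\<^sup>2 = s * (\<bar>v t \<bullet> \<eta>\<bar> / norm (v t))\<^sup>2" using s by (simp add: w_def power_mult_distrib power_divide)
    also have "\<dots> \<le> s * (norm \<eta>)\<^sup>2"
      using s Cauchy_Schwarz_ineq2[of "v t" \<eta>]
      by (intro mult_left_mono power_mono) (auto simp: divide_le_eq mult.commute)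
    finally have w: "w\<^sup>2 \<le> s * (\<eta> \<bullet> \<eta>)" by (simp add: power2_norm_eq_inner)
    have neg: "Nz ?p \<le> 0" using S[OF t] by (rule Nz_nonpos)
    \<comment> \<open>The second derivative splits into the quadratic form at \<open>\<xi>\<close>
      and \<open>w\<close>, the term \<open>- 2 * Nz ?p * \<xi>\<^sup>2\<close>, and a remainder
      that is nonpositive because \<open>Nz ?p\<close> is and because \<open>w\<^sup>2\<close> is at
      most \<open>s * (\<eta> \<bullet> \<eta>)\<close>.\<close>
    have "(h1 t)\<^sup>2 = 4 * h t * w\<^sup>2" using hx[of t] by (simp add: hw power_mult_distrib)
    then have "(Nxx ?p * \<xi> + Nxz ?p * h1 t) * \<xi> + ((Nxz ?p * \<xi> + Nzz ?p * h1 t) * h1 t + Nz ?p * (2 * s * (\<eta> \<bullet> \<eta>)))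
      = ((Nxx ?p + 2 * Nz ?p) * \<xi>\<^sup>2 + 4 * sqrt (h t) * Nxz ?p * (\<xi> * w) + (2 * Nz ?p + 4 * h t * Nzz ?p) * w\<^sup>2)
        - 2 * Nz ?p * \<xi>\<^sup>2 + 2 * (Nz ?p * (s * (\<eta> \<bullet> \<eta>) - w\<^sup>2))"
      using hx[of t] unfolding hw by (simp add: algebra_simps power2_eq_square)
    also have "\<dots> \<le> - 2 * Nz ?p * \<xi>\<^sup>2"
      using form[OF S[OF t], of \<xi> w] mult_nonpos_nonneg[OF neg, of "s * (\<eta> \<bullet> \<eta>) - w\<^sup>2"] w by simp
    also have "\<dots> = 2 * ((- Nz ?p) * \<xi>\<^sup>2)" by simp
    also have "\<dots> \<le> 2 * (D * \<xi>\<^sup>2)"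
    proof -
      \<comment> \<open>\<open>Nz\<close> at the running point is compared with its value at the
        start of the segment. The second coordinate moves by at most
        \<open>2 * L * norm \<eta>\<close>, as a difference of squares of norms bounded by
        \<open>L\<close>.\<close>
      have "\<bar>Nz p0 - Nz ?p\<bar> \<le> K * (\<bar>fst p0 - fst ?p\<bar> + \<bar>snd p0 - snd ?p\<bar>)"
        using gx[OF t] hL[OF t] hx x(1) s hL[of 0] hx[of 0] by (intro K) (auto simp: p0_def h_def v_def)
      also have "\<bar>fst p0 - fst ?p\<bar> + \<bar>snd p0 - snd ?p\<bar> \<le> \<bar>\<xi>\<bar> + 2 * L * norm \<eta>"
      proof (rule add_mono)
        show "\<bar>fst p0 - fst ?p\<bar> \<le> \<bar>\<xi>\<bar>" using t by (simp add: p0_def g_def abs_mult mult_left_le_one_le)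
        have "norm v0 - norm (v t) \<le> norm \<eta>" "norm (v t) - norm v0 \<le> norm \<eta>"
        proof -
          have "norm (v t - v0) \<le> norm \<eta>" using t by (simp add: v_def mult_left_le_one_le)
          then show "norm v0 - norm (v t) \<le> norm \<eta>" "norm (v t) - norm v0 \<le> norm \<eta>"
            using norm_triangle_ineq2[of "v t" v0] norm_triangle_ineq2[of v0 "v t"] by (auto simp: norm_minus_commute)
        qed
        then have d: "\<bar>norm v0 - norm (v t)\<bar> \<le> norm \<eta>" by linarith
        have "\<bar>snd p0 - snd ?p\<bar> = s * (\<bar>norm v0 - norm (v t)\<bar> * (norm v0 + norm (v t)))"
          using s unfolding p0_def h_def snd_conv right_diff_distrib[symmetric] abs_mult
          by (simp add: power2_eq_square square_diff_square_factored abs_mult)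
        also have "\<dots> \<le> 1 * (norm \<eta> * (L + L))"
          using s d L(1) vL[OF t] by (intro mult_mono add_mono) auto
        finally show "\<bar>snd p0 - snd ?p\<bar> \<le> 2 * L * norm \<eta>" by (simp add: mult_ac)
      qed
      finally have "\<bar>Nz p0 - Nz ?p\<bar> \<le> K * (\<bar>\<xi>\<bar> + 2 * L * norm \<eta>)" using K0 by (simp add: mult_left_mono)
      then have "- Nz ?p \<le> D" unfolding D_def by linarith
      then have "(- Nz ?p) * \<xi>\<^sup>2 \<le> D * \<xi>\<^sup>2" by (rule mult_right_mono) simp
      then show ?thesis by linarith
    qed
    finally show ?thesis .
  qed
  have "N (g 1, h 1) \<le> N (g 0, h 0) + (Nx (g 0, h 0) * \<xi> + Nz (g 0, h 0) * h1 0) + D * \<xi>\<^sup>2"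
    by (rule second_order_upper_bound[OF d1 d2 bound])
  then show ?thesis
    by (simp add: g_def h_def h1_def v_def D_def \<xi>_def \<eta>_def p0_def)
qed

end

section \<open>Regularity up to the boundary and translation of the matrix condition\<close>

lemma Ck_on_1_lipschitz:
  fixes g :: "'a::euclidean_space \<Rightarrow> real"
  assumes g: "Ck_on (Suc 0) S g" and K: "K \<subseteq> S" "compact K" "convex K"
  shows "\<exists>C\<ge>0. \<forall>x\<in>K. \<forall>y\<in>K. \<bar>g x - g y\<bar> \<le> C * norm (x - y)"
proof -
  obtain g' where g': "\<And>p. p \<in> S \<Longrightarrow> (g has_derivative g' p) (at p within S)"
    and c: "\<And>v. continuous_on S (\<lambda>p. g' p v)"
    using g by auto
  \<comment> \<open>The derivative is known to be continuous for each fixed direction; the bounds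
    for the basis vectors add up to a bound for its operator norm.\<close>
  have "\<exists>B\<ge>0. \<forall>p\<in>K. \<bar>g' p v\<bar> \<le> B" for v
  proof -
    have "bounded ((\<lambda>p. g' p v) ` K)"
      using K by (intro compact_imp_bounded compact_continuous_image continuous_on_subset[OF c])
    then obtain B where "\<forall>p\<in>K. \<bar>g' p v\<bar> \<le> B" by (auto simp: bounded_iff)
    then show ?thesis by (intro exI[of _ "\<bar>B\<bar>"]) force
  qed
  then obtain B where B: "\<And>v. 0 \<le> B v" "\<And>v p. p \<in> K \<Longrightarrow> \<bar>g' p v\<bar> \<le> B v" by metis
  define C where "C = sum B Basis"
  have on: "onorm (g' p) \<le> C" if p: "p \<in> K" for p
  proof (rule onorm_le)
    fix v
    interpret linear "g' p" using g'[of p] p K(1) has_derivative_linear by blast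
    have "g' p v = (\<Sum>b\<in>Basis. (v \<bullet> b) * g' p b)"
      by (subst euclidean_representation[of v, symmetric]) (simp add: sum scale del: euclidean_representation)
    also have "\<bar>\<dots>\<bar> \<le> (\<Sum>b\<in>Basis. norm v * B b)"
      unfolding sum_distrib_left[symmetric]
    proof (rule order_trans[OF sum_abs])
      show "(\<Sum>b\<in>Basis. \<bar>(v \<bullet> b) * g' p b\<bar>) \<le> norm v * sum B Basis"
        unfolding sum_distrib_left abs_mult using B p
        by (intro sum_mono mult_mono) (auto simp: Basis_le_norm)
    qed
    also have "\<dots> = C * norm v" by (simp add: C_def sum_distrib_left mult.commute)
    finally show "norm (g' p v) \<le> C * norm v" by simp
  qed
  have "(g has_derivative g' p) (at p within K)" if "p \<in> K" for p
    using g'[of p] K(1) that by (auto intro: has_derivative_subset)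
  then have "norm (g x - g y) \<le> C * norm (x - y)" if "x \<in> K" "y \<in> K" for x y
    using that by (intro differentiable_bound[OF K(3) _ on])
  then show ?thesis using B by (intro exI[of _ C]) (auto simp: C_def sum_nonneg)
qed

text \<open>The mean value theorem in the first variable for the difference of the slices at
  \<open>z1\<close> and \<open>z0\<close>, and then in the second variable for
  \<open>Fx\<close>.\<close>

lemma mixed_partials_mean_value:
  fixes F :: "real \<times> real \<Rightarrow> real"
  assumes dF: "\<And>p. p \<in> S \<Longrightarrow> (F has_derivative (\<lambda>v. Fx p * fst v + Fz p * snd v)) (at p within S)"
    and dFx: "\<And>p. p \<in> S \<Longrightarrow> (Fx has_derivative (\<lambda>v. Fxx p * fst v + Fxz p * snd v)) (at p within S)"
    and S: "{x0..x1} \<times> {z0..z1} \<subseteq> S" and x: "x0 < x1" and z: "z0 < z1"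
  shows "\<exists>p\<in>{x0..x1} \<times> {z0..z1}.
    F (x1, z1) - F (x0, z1) - F (x1, z0) + F (x0, z0) = (x1 - x0) * (z1 - z0) * Fxz p"
proof -
  have "((\<lambda>s. F (s, z1) - F (s, z0)) has_field_derivative
     ((Fx (s, z1) * 1 + Fz (s, z1) * 0) - (Fx (s, z0) * 1 + Fz (s, z0) * 0))) (at s within {x0..x1})"
    if "s \<in> {x0..x1}" for s
    using that S z by (intro DERIV_diff has_field_derivative_along_curve[OF dF] DERIV_ident DERIV_const) auto
  then have "\<exists>s\<in>{x0<..<x1}. (F (x1, z1) - F (x1, z0)) - (F (x0, z1) - F (x0, z0)) = (Fx (s, z1) - Fx (s, z0)) * (x1 - x0)"
    by (intro mvt_simple[OF x]) (auto simp: has_field_derivative_def)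
  then obtain s where s: "s \<in> {x0<..<x1}"
    "(F (x1, z1) - F (x1, z0)) - (F (x0, z1) - F (x0, z0)) = (Fx (s, z1) - Fx (s, z0)) * (x1 - x0)" by blast
  have "((\<lambda>t. Fx (s, t)) has_field_derivative (Fxx (s, t) * 0 + Fxz (s, t) * 1)) (at t within {z0..z1})"
    if "t \<in> {z0..z1}" for t
    using that S s by (intro has_field_derivative_along_curve[OF dFx] DERIV_ident DERIV_const) auto
  then have "\<exists>t\<in>{z0<..<z1}. Fx (s, z1) - Fx (s, z0) = Fxz (s, t) * (z1 - z0)"
    by (intro mvt_simple[OF z]) (auto simp: has_field_derivative_def)
  then obtain t where t: "t \<in> {z0<..<z1}" "Fx (s, z1) - Fx (s, z0) = Fxz (s, t) * (z1 - z0)" by blast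
  show ?thesis
    using s t by (intro bexI[of _ "(s, t)"]) (auto simp: algebra_simps)
qed

text \<open>Allows \<open>mixed_partials_mean_value\<close> to be applied with the roles of the
  variables exchanged.\<close>

lemma has_derivative_swap_args:
  fixes F :: "real \<times> real \<Rightarrow> real"
  assumes "\<And>p. p \<in> S \<Longrightarrow> (F has_derivative (\<lambda>v. Fx p * fst v + Fz p * snd v)) (at p within S)"
    and "p \<in> prod.swap ` S"
  shows "((\<lambda>p. F (prod.swap p)) has_derivative (\<lambda>v. Fz (prod.swap p) * fst v + Fx (prod.swap p) * snd v)) (at p within prod.swap ` S)"
proof -
  have "bounded_linear (prod.swap :: real \<times> real \<Rightarrow> real \<times> real)"
    unfolding prod.swap_def by (intro bounded_linear_intros)
  then have "(prod.swap has_derivative prod.swap) (at p within prod.swap ` S)"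
    by (rule bounded_linear_imp_has_derivative)
  moreover have "prod.swap p \<in> S" using assms(2) by auto
  ultimately show ?thesis
    using has_derivative_in_compose[of prod.swap prod.swap p "prod.swap ` S" F "\<lambda>v. Fx (prod.swap p) * fst v + Fz (prod.swap p) * snd v"] assms(1)[of "prod.swap p"]
    by (simp add: image_image add.commute)
qed

text \<open>Schwarz's theorem, boundary points included: the second difference over a small square
  near \<open>p\<close> is its area times a value of \<open>Fxz\<close>, and also its area times a
  value of \<open>Fzx\<close>, and both functions are continuous at \<open>p\<close>.\<close>

lemma mixed_partials_eq:
  fixes a b :: real and F :: "real \<times> real \<Rightarrow> real"
  defines "S \<equiv> {a..b} \<times> {0..}"
  assumes ab: "a < b"
    and dF: "\<And>p. p \<in> S \<Longrightarrow> (F has_derivative (\<lambda>v. Fx p * fst v + Fz p * snd v)) (at p within S)"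
    and dFx: "\<And>p. p \<in> S \<Longrightarrow> (Fx has_derivative (\<lambda>v. Fxx p * fst v + Fxz p * snd v)) (at p within S)"
    and dFz: "\<And>p. p \<in> S \<Longrightarrow> (Fz has_derivative (\<lambda>v. Fzx p * fst v + Fzz p * snd v)) (at p within S)"
    and c: "continuous_on S Fxz" "continuous_on S Fzx" and p: "p \<in> S"
  shows "Fxz p = Fzx p"
proof (rule ccontr)
  assume "Fxz p \<noteq> Fzx p"
  define e where "e = \<bar>Fxz p - Fzx p\<bar> / 2"
  have e: "e > 0" using \<open>Fxz p \<noteq> Fzx p\<close> by (simp add: e_def)
  obtain x z where pz: "p = (x, z)" "x \<in> {a..b}" "0 \<le> z" using p by (cases p) (auto simp: S_def)
  obtain d1 where d1: "d1 > 0" "\<And>q. q \<in> S \<Longrightarrow> dist q p < d1 \<Longrightarrow> dist (Fxz q) (Fxz p) < e"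
    using c(1) p e unfolding continuous_on_iff by blast
  obtain d2 where d2: "d2 > 0" "\<And>q. q \<in> S \<Longrightarrow> dist q p < d2 \<Longrightarrow> dist (Fzx q) (Fzx p) < e"
    using c(2) p e unfolding continuous_on_iff by blast
  \<comment> \<open>Points of a square of side \<open>h\<close> containing \<open>p\<close> are
    within \<open>2 * h\<close> of \<open>p\<close>, hence closer than \<open>d1\<close> and
    \<open>d2\<close>. The bound by a third of \<open>b - a\<close> leaves room for the square on
    one side of \<open>x\<close>.\<close>
  define h where "h = min (min d1 d2 / 3) ((b - a) / 3)"
  have h: "0 < h" "h \<le> d1 / 3" "h \<le> d2 / 3" "h \<le> (b - a) / 3" using d1(1) d2(1) ab by (simp_all add: h_def min_def)
  \<comment> \<open>Near the right endpoint the square is placed to the left of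
    \<open>x\<close>.\<close>
  define x0 where "x0 = (if x + h \<le> b then x else x - h)"
  have x0: "a \<le> x0" "x0 + h \<le> b" "x0 \<le> x" "x \<le> x0 + h" using h pz(2) by (auto simp: x0_def field_simps)
  have R: "{x0..x0 + h} \<times> {z..z + h} \<subseteq> S" using x0 pz by (auto simp: S_def)
  have near: "dist q p < d1 \<and> dist q p < d2" if q: "q \<in> {x0..x0 + h} \<times> {z..z + h}" for q
  proof -
    have "dist (fst q) x \<le> h" "dist (snd q) z \<le> h" using q x0 by (auto simp: dist_real_def)
    then have "dist q p \<le> h + h"
      using sqrt_sum_squares_le_sum[of "dist (fst q) x" "dist (snd q) z"] by (simp add: pz dist_prod_def)
    then show ?thesis using h by linarith
  qed
  obtain q where q: "q \<in> {x0..x0 + h} \<times> {z..z + h}"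
    "F (x0 + h, z + h) - F (x0, z + h) - F (x0 + h, z) + F (x0, z) = (x0 + h - x0) * (z + h - z) * Fxz q"
    using mixed_partials_mean_value[OF dF dFx R] h(1) by auto
  have R': "{z..z + h} \<times> {x0..x0 + h} \<subseteq> prod.swap ` S"
  proof
    fix q assume "q \<in> {z..z + h} \<times> {x0..x0 + h}"
    then have "prod.swap q \<in> S" using R by auto
    then show "q \<in> prod.swap ` S" by (intro image_eqI[of _ _ "prod.swap q"]) auto
  qed
  have "\<exists>q'\<in>{z..z + h} \<times> {x0..x0 + h}.
     F (prod.swap (z + h, x0 + h)) - F (prod.swap (z, x0 + h)) - F (prod.swap (z + h, x0)) + F (prod.swap (z, x0))
      = (z + h - z) * (x0 + h - x0) * Fzx (prod.swap q')"
    using h(1) by (intro mixed_partials_mean_value[OF has_derivative_swap_args[OF dF] has_derivative_swap_args[OF dFz] R']) simp_all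
  then obtain q' where q': "q' \<in> {z..z + h} \<times> {x0..x0 + h}"
    "F (x0 + h, z + h) - F (x0 + h, z) - F (x0, z + h) + F (x0, z) = (z + h - z) * (x0 + h - x0) * Fzx (prod.swap q')"
    unfolding swap_simp by blast
  have "(x0 + h - x0) * (z + h - z) * Fxz q = (z + h - z) * (x0 + h - x0) * Fzx (prod.swap q')"
    unfolding q(2)[symmetric] q'(2)[symmetric] by simp
  then have "Fxz q = Fzx (prod.swap q')" using h(1) by simp
  moreover have q'': "prod.swap q' \<in> {x0..x0 + h} \<times> {z..z + h}" using q'(1) by auto
  ultimately have "dist (Fxz q) (Fxz p) < e" "dist (Fxz q) (Fzx p) < e"
    using d1(2)[of q] d2(2)[of "prod.swap q'"] near[OF q(1)] near[OF q''] subsetD[OF R q(1)] subsetD[OF R q''] by simp_all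
  moreover have "dist (Fxz p) (Fzx p) \<le> dist (Fxz q) (Fxz p) + dist (Fxz q) (Fzx p)"
    by (rule dist_triangle3)
  moreover have "dist (Fxz p) (Fzx p) = e + e" unfolding e_def dist_real_def by (rule field_sum_of_halves[symmetric])
  ultimately show False by linarith
qed

lemma Ck_on_pair_partials:
  fixes F :: "real \<times> real \<Rightarrow> real"
  assumes "Ck_on (Suc k) S F"
  shows "\<exists>Fx Fz. (\<forall>p\<in>S. (F has_derivative (\<lambda>v. Fx p * fst v + Fz p * snd v)) (at p within S)) \<and>
    Ck_on k S Fx \<and> Ck_on k S Fz"
proof -
  obtain F' where F': "\<And>p. p \<in> S \<Longrightarrow> (F has_derivative F' p) (at p within S)" "\<And>v. Ck_on k S (\<lambda>p. F' p v)"
    using assms by auto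
  have "(F has_derivative (\<lambda>v. F' p (1, 0) * fst v + F' p (0, 1) * snd v)) (at p within S)" if "p \<in> S" for p
  proof (rule has_derivative_eq_rhs[OF F'(1)[OF that]], rule ext)
    fix v :: "real \<times> real"
    interpret linear "F' p" using F'(1)[OF that] has_derivative_linear by blast
    have "v = fst v *\<^sub>R (1, 0) + snd v *\<^sub>R (0, 1)" by (simp add: prod_eq_iff)
    then have "F' p v = F' p (fst v *\<^sub>R (1, 0) + snd v *\<^sub>R (0, 1))" by simp
    also have "\<dots> = fst v * F' p (1, 0) + snd v * F' p (0, 1)" by (simp only: add scale real_scaleR_def)
    finally show "F' p v = F' p (1, 0) * fst v + F' p (0, 1) * snd v" by (simp add: mult.commute)
  qed
  with F'(2) show ?thesis
    by (intro exI[of _ "\<lambda>p. F' p (1, 0)"] exI[of _ "\<lambda>p. F' p (0, 1)"]) simp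
qed

lemma negative_semidefinite_2:
  assumes "negative_semidefinite (vector [vector [A, B], vector [B, D]] :: real ^ 2 ^ 2)"
  shows "A * u\<^sup>2 + 2 * B * (u * w) + D * w\<^sup>2 \<le> 0"
proof -
  let ?A = "vector [vector [A, B], vector [B, D]] :: real ^ 2 ^ 2" and ?v = "vector [u, w] :: real ^ 2"
  have "?v \<bullet> (?A *v ?v) \<le> 0" using assms by (simp add: negative_semidefinite_def)
  also have "?v \<bullet> (?A *v ?v) = A * u\<^sup>2 + 2 * B * (u * w) + D * w\<^sup>2"
    by (simp add: inner_vec_def matrix_vector_mult_def sum_2 power2_eq_square algebra_simps)
  finally show ?thesis .
qed

lemma partial_x_eqI:
  assumes "a < b" "x \<in> {a..b}" "((\<lambda>s. F s y) has_field_derivative D) (at x within {a..b})"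
  shows "partial_x {a..b} F x y = D"
  unfolding partial_x_def
  using assms by (intro vector_derivative_within_closed_interval)
    (auto simp: has_real_derivative_iff_has_vector_derivative)

text \<open>The matrix entries at \<open>(x, y)\<close> are expressed by the partial derivatives of
  \<open>N\<close> at \<open>(x, y\<^sup>2)\<close>, which turns the hypothesis into the quadratic
  form inequality for \<open>z > 0\<close>. The boundary \<open>z = 0\<close> follows by continuity,
  and the sign of \<open>Nz\<close> from the lower right entry alone.\<close>

lemma concave_profile_of_M_matrix:
  fixes a b :: real and M :: "real \<Rightarrow> real \<Rightarrow> real"
  assumes ab: "a < b"
    and M: "Ck_on 2 ({a..b} \<times> {0..}) (\<lambda>(x, y). M x (sqrt y))"
    and neg: "\<And>x y. x \<in> {a..b} \<Longrightarrow> y > 0 \<Longrightarrow> negative_semidefinite (M_matrix {a..b} M x y)"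
  shows "\<exists>Nx Nz Nxx Nxz Nzz. concave_profile a b (\<lambda>(x, y). M x (sqrt y)) Nx Nz Nxx Nxz Nzz"
proof -
  define N where "N = (\<lambda>(x, y). M x (sqrt y))"
  let ?S = "{a..b} \<times> {0..}"
  have "Ck_on (Suc (Suc 0)) ?S N" using M by (simp add: N_def numeral_2_eq_2)
  then obtain Nx Nz where dN: "\<And>p. p \<in> ?S \<Longrightarrow> (N has_derivative (\<lambda>v. Nx p * fst v + Nz p * snd v)) (at p within ?S)"
    and C1: "Ck_on (Suc 0) ?S Nx" "Ck_on (Suc 0) ?S Nz" using Ck_on_pair_partials by blast
  obtain Nxx Nxz where dNx: "\<And>p. p \<in> ?S \<Longrightarrow> (Nx has_derivative (\<lambda>v. Nxx p * fst v + Nxz p * snd v)) (at p within ?S)"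
    and "Ck_on 0 ?S Nxx" "Ck_on 0 ?S Nxz" using Ck_on_pair_partials[OF C1(1)] by blast
  then have cx: "continuous_on ?S Nxx" "continuous_on ?S Nxz" by simp_all
  obtain Nzx Nzz where dNz': "\<And>p. p \<in> ?S \<Longrightarrow> (Nz has_derivative (\<lambda>v. Nzx p * fst v + Nzz p * snd v)) (at p within ?S)"
    and "Ck_on 0 ?S Nzx" "Ck_on 0 ?S Nzz" using Ck_on_pair_partials[OF C1(2)] by blast
  then have cz: "continuous_on ?S Nzx" "continuous_on ?S Nzz" by simp_all
  have sym: "Nxz p = Nzx p" if "p \<in> ?S" for p
    using mixed_partials_eq[OF ab dN dNx dNz' cx(2) cz(1)] that by blast
  have dNz: "(Nz has_derivative (\<lambda>v. Nxz p * fst v + Nzz p * snd v)) (at p within ?S)" if "p \<in> ?S" for p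
    using dNz'[OF that] sym[OF that] by simp
  have cNz: "continuous_on ?S Nz" by (rule has_derivative_continuous_on[OF dNz])
  have MN: "M x t = N (x, t\<^sup>2)" if "0 \<le> t" for x t using that by (simp add: N_def)

  have Mx: "partial_x {a..b} M x y = Nx (x, y\<^sup>2)" if x: "x \<in> {a..b}" and y: "0 \<le> y" for x y
  proof -
    have "((\<lambda>s. M s y) has_field_derivative (Nx (x, y\<^sup>2) * 1 + Nz (x, y\<^sup>2) * 0)) (at x within {a..b})"
      unfolding MN[OF y]
      using x by (intro has_field_derivative_along_curve[OF dN] DERIV_ident DERIV_const) auto
    from partial_x_eqI[of a b x M y, OF ab x this] show ?thesis by simp
  qed
  have Mxx: "partial_x {a..b} (partial_x {a..b} M) x y = Nxx (x, y\<^sup>2)" if x: "x \<in> {a..b}" and y: "0 \<le> y" for x y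
  proof -
    have "((\<lambda>s. Nx (s, y\<^sup>2)) has_field_derivative (Nxx (x, y\<^sup>2) * 1 + Nxz (x, y\<^sup>2) * 0)) (at x within {a..b})"
      using x by (intro has_field_derivative_along_curve[OF dNx] DERIV_ident DERIV_const) auto
    then have "((\<lambda>s. partial_x {a..b} M s y) has_field_derivative (Nxx (x, y\<^sup>2) * 1 + Nxz (x, y\<^sup>2) * 0)) (at x within {a..b})"
      using x y by - (rule has_field_derivative_transform_within[where d=1 and f="\<lambda>s. Nx (s, y\<^sup>2)"], simp_all add: Mx)
    from partial_x_eqI[of a b x "partial_x {a..b} M" y, OF ab x this] show ?thesis by simp
  qed
  \<comment> \<open>Since \<open>t\<^sup>2\<close> lies in the domain for every real
    \<open>t\<close>, the derivative is two-sided, even at \<open>y = 0\<close>.\<close>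
  have dy: "((\<lambda>t. F (x, t\<^sup>2)) has_field_derivative (Fx (x, y\<^sup>2) * 0 + Fz (x, y\<^sup>2) * (2 * y))) (at y)"
    if F: "\<And>p. p \<in> ?S \<Longrightarrow> (F has_derivative (\<lambda>v. Fx p * fst v + Fz p * snd v)) (at p within ?S)"
      and x: "x \<in> {a..b}" for F Fx Fz :: "real \<times> real \<Rightarrow> real" and x y
    using x by (intro has_field_derivative_along_curve[OF F]) (auto intro!: derivative_eq_intros)
  \<comment> \<open>\<open>M x t = N (x, t\<^sup>2)\<close> is available for nonnegative
    \<open>t\<close>, so the derivatives are compared on the open half-line.\<close>
  have My: "partial_y M x y = 2 * y * Nz (x, y\<^sup>2)" if x: "x \<in> {a..b}" and y: "0 < y" for x y
    unfolding partial_y_def using dy[OF dN x, of y] y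
    by - (rule DERIV_imp_deriv, rule has_field_derivative_transform_within_open[where f="\<lambda>t. N (x, t\<^sup>2)" and S="{0<..}"],
      auto simp: MN mult.commute)
  have Mxy: "partial_y (partial_x {a..b} M) x y = 2 * y * Nxz (x, y\<^sup>2)" if x: "x \<in> {a..b}" and y: "0 < y" for x y
    unfolding partial_y_def using dy[OF dNx x, of y] x y
    by - (rule DERIV_imp_deriv, rule has_field_derivative_transform_within_open[where f="\<lambda>t. Nx (x, t\<^sup>2)" and S="{0<..}"],
      auto simp: Mx mult.commute)
  have Myy: "partial_y (partial_y M) x y = 2 * Nz (x, y\<^sup>2) + 4 * y\<^sup>2 * Nzz (x, y\<^sup>2)" if x: "x \<in> {a..b}" and y: "0 < y" for x y
  proof -
    have "((\<lambda>t. 2 * t * Nz (x, t\<^sup>2)) has_field_derivative (2 * Nz (x, y\<^sup>2) + 4 * y\<^sup>2 * Nzz (x, y\<^sup>2))) (at y)"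
      using dy[OF dNz x, of y] by (auto intro!: derivative_eq_intros simp: power2_eq_square)
    then show ?thesis unfolding partial_y_def[of "partial_y M"] using x y
      by - (rule DERIV_imp_deriv, rule has_field_derivative_transform_within_open[where f="\<lambda>t. 2 * t * Nz (x, t\<^sup>2)" and S="{0<..}"],
        auto simp: My)
  qed
  define \<Phi> where "\<Phi> u w p = (Nxx p + 2 * Nz p) * u\<^sup>2 + 4 * sqrt (snd p) * Nxz p * (u * w)
      + (2 * Nz p + 4 * snd p * Nzz p) * w\<^sup>2" for u w p
  have \<Phi>pos: "\<Phi> u w (x, z) \<le> 0" if x: "x \<in> {a..b}" and z: "0 < z" for x z u w
  proof -
    let ?y = "sqrt z"
    have y: "0 < ?y" using z by simp
    have "M_matrix {a..b} M x ?y = vector [vector [Nxx (x, z) + 2 * Nz (x, z), 2 * ?y * Nxz (x, z)],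
        vector [2 * ?y * Nxz (x, z), 2 * Nz (x, z) + 4 * z * Nzz (x, z)]]"
      using x y z by (simp add: M_matrix_def Mxx My Mxy Myy)
    then show ?thesis
      using negative_semidefinite_2[of "Nxx (x, z) + 2 * Nz (x, z)" "2 * ?y * Nxz (x, z)" "2 * Nz (x, z) + 4 * z * Nzz (x, z)" u w]
        neg[OF x y] by (simp add: \<Phi>_def)
  qed
  \<comment> \<open>Continuity in \<open>z\<close> carries the inequality from the open half-line to
    its closure.\<close>
  have \<Phi>: "\<Phi> u w p \<le> 0" if pS: "p \<in> ?S" for p u w
  proof -
    obtain x z where p: "p = (x, z)" "x \<in> {a..b}" "0 \<le> z" using pS by (cases p) auto
    have "continuous_on ?S (\<Phi> u w)"
      unfolding \<Phi>_def by (intro continuous_intros cx cz cNz)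
    then have "continuous_on (closure {0<..}) (\<lambda>z. \<Phi> u w (x, z))"
      using p by (intro continuous_on_compose2[of _ "\<Phi> u w" _ "\<lambda>z. (x, z)"] continuous_intros) auto
    then have "\<Phi> u w (x, z) \<le> 0"
      by (rule continuous_le_on_closure) (use p \<Phi>pos in auto)
    then show ?thesis by (simp add: p)
  qed
  have Nz_le: "Nz p \<le> 0" if pS: "p \<in> ?S" for p
  proof -
    obtain x z where p: "p = (x, z)" "x \<in> {a..b}" "0 \<le> z" using pS by (cases p) auto
    show ?thesis
    proof (cases "z = 0")
      case True then show ?thesis using \<Phi>[OF pS, of 0 1] by (simp add: p \<Phi>_def)
    next
      case False
      let ?y = "sqrt z"
      have y: "0 < ?y" using False p by simp
      \<comment> \<open>As a function of \<open>y\<close>, \<open>2 * y * Nz (x, y\<^sup>2)\<close>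
        is the partial derivative of \<open>M\<close> for \<open>y > 0\<close>. It vanishes at 0,
        and its own derivative is the lower right matrix entry, hence nonpositive.\<close>
      have "\<exists>t\<in>{0<..<?y}. 2 * ?y * Nz (x, ?y\<^sup>2) - 2 * 0 * Nz (x, 0\<^sup>2) = (2 * Nz (x, t\<^sup>2) + 4 * t\<^sup>2 * Nzz (x, t\<^sup>2)) * (?y - 0)"
      proof (rule mvt_simple[OF y])
        fix t
        have "((\<lambda>t. 2 * t * Nz (x, t\<^sup>2)) has_field_derivative (2 * Nz (x, t\<^sup>2) + 4 * t\<^sup>2 * Nzz (x, t\<^sup>2))) (at t)"
          using dy[OF dNz p(2), of t] by (auto intro!: derivative_eq_intros simp: power2_eq_square)
        then show "((\<lambda>t. 2 * t * Nz (x, t\<^sup>2)) has_derivative (*) (2 * Nz (x, t\<^sup>2) + 4 * t\<^sup>2 * Nzz (x, t\<^sup>2))) (at t within {0..?y})"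
          by - (rule has_derivative_at_withinI, simp add: has_field_derivative_def)
      qed
      then obtain t where t: "0 < t" "2 * ?y * Nz (x, z) = (2 * Nz (x, t\<^sup>2) + 4 * t\<^sup>2 * Nzz (x, t\<^sup>2)) * ?y"
        using p by auto
      have "2 * Nz (x, t\<^sup>2) + 4 * t\<^sup>2 * Nzz (x, t\<^sup>2) \<le> 0"
        using \<Phi>[of "(x, t\<^sup>2)" 0 1] p(2) by (simp add: \<Phi>_def)
      moreover have "(2 * Nz (x, z)) * ?y = (2 * Nz (x, t\<^sup>2) + 4 * t\<^sup>2 * Nzz (x, t\<^sup>2)) * ?y"
        using t(2) by (simp only: mult_ac)
      then have "2 * Nz (x, z) = 2 * Nz (x, t\<^sup>2) + 4 * t\<^sup>2 * Nzz (x, t\<^sup>2)"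
        using y unfolding mult_cancel_right by simp
      ultimately show ?thesis by (simp add: p)
    qed
  qed
  have lip: "\<exists>K\<ge>0. \<forall>p\<in>{a..b} \<times> {0..R}. \<forall>q\<in>{a..b} \<times> {0..R}.
      \<bar>Nz p - Nz q\<bar> \<le> K * (\<bar>fst p - fst q\<bar> + \<bar>snd p - snd q\<bar>)" for R
  proof -
    have "\<exists>K\<ge>0. \<forall>p\<in>{a..b} \<times> {0..R}. \<forall>q\<in>{a..b} \<times> {0..R}. \<bar>Nz p - Nz q\<bar> \<le> K * norm (p - q)"
      by (rule Ck_on_1_lipschitz[OF C1(2)]) (auto intro: compact_Times convex_Times)
    then obtain K where K: "K \<ge> 0"
      "\<And>p q. p \<in> {a..b} \<times> {0..R} \<Longrightarrow> q \<in> {a..b} \<times> {0..R} \<Longrightarrow> \<bar>Nz p - Nz q\<bar> \<le> K * norm (p - q)"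
      by blast
    have "norm (p - q) \<le> \<bar>fst p - fst q\<bar> + \<bar>snd p - snd q\<bar>" for p q :: "real \<times> real"
      using sqrt_sum_squares_le_sum_abs[of "fst p - fst q" "snd p - snd q"] by (simp add: norm_prod_def)
    then have "K * norm (p - q) \<le> K * (\<bar>fst p - fst q\<bar> + \<bar>snd p - snd q\<bar>)" for p q :: "real \<times> real"
      using K(1) by (rule mult_left_mono)
    then show ?thesis using K by (meson order_trans)
  qed
  have "concave_profile a b N Nx Nz Nxx Nxz Nzz"
    using \<Phi> Nz_le by (intro concave_profile.intro ab dN dNx dNz lip) (auto simp: \<Phi>_def)
  then show ?thesis unfolding N_def by blast
qed

section \<open>The inequality for bounded Lipschitz gradients\<close>

text \<open>
  The last condition says that \<open>P\<close> is the gradient of \<open>v\<close>, in a form that passes to averages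
  without differentiating under the integral sign.
\<close>

definition C11_pair :: "real \<Rightarrow> real \<Rightarrow> real \<Rightarrow> (real ^ 'n \<Rightarrow> real) \<Rightarrow> (real ^ 'n \<Rightarrow> real ^ 'n) \<Rightarrow> bool" where
  "C11_pair a b L v P \<longleftrightarrow> (\<forall>x. v x \<in> {a..b}) \<and> (\<forall>x. norm (P x) \<le> L) \<and>
     (\<forall>x y. \<bar>v y - v x\<bar> \<le> L * norm (y - x)) \<and> (\<forall>x y. norm (P y - P x) \<le> L * norm (y - x)) \<and>
     (\<forall>x y. \<bar>v y - v x - P x \<bullet> (y - x)\<bar> \<le> L * (norm (y - x))\<^sup>2)"

lemma continuous_on_lipschitz_bound:
  fixes g :: "'a::real_normed_vector \<Rightarrow> 'b::real_normed_vector"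
  assumes "\<And>x y. norm (g y - g x) \<le> L * norm (y - x)"
  shows "continuous_on UNIV g"
proof -
  have "dist (g x) (g y) \<le> \<bar>L\<bar> * dist x y" for x y
  proof -
    have "dist (g x) (g y) \<le> L * dist x y" using assms[of x y] by (simp add: dist_norm)
    also have "\<dots> \<le> \<bar>L\<bar> * dist x y" by (intro mult_right_mono) auto
    finally show ?thesis .
  qed
  then have "\<bar>L\<bar>-lipschitz_on UNIV g" by (intro lipschitz_onI) auto
  then show ?thesis by (rule lipschitz_on_continuous_on)
qed

lemma C11_pairD:
  assumes "C11_pair a b L v P"
  shows "v x \<in> {a..b}" "norm (P x) \<le> L" "\<bar>v y - v x\<bar> \<le> L * norm (y - x)"
    "norm (P y - P x) \<le> L * norm (y - x)" "\<bar>v y - v x - P x \<bullet> (y - x)\<bar> \<le> L * (norm (y - x))\<^sup>2"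
    "0 \<le> L" "\<bar>v x\<bar> \<le> \<bar>a\<bar> + \<bar>b\<bar>"
proof -
  have *: "\<forall>x. v x \<in> {a..b}" "\<forall>x. norm (P x) \<le> L" using assms unfolding C11_pair_def by blast+
  show "0 \<le> L" using *(2) norm_ge_zero[of "P x"] order_trans by blast
  have "a \<le> v x" "v x \<le> b" using *(1) by auto
  then show "\<bar>v x\<bar> \<le> \<bar>a\<bar> + \<bar>b\<bar>" by linarith
qed (use assms in \<open>simp_all add: C11_pair_def\<close>)

lemma C11_pair_continuous:
  assumes "C11_pair a b L v P"
  shows "continuous_on UNIV v" "continuous_on UNIV P"
  using C11_pairD[OF assms] by (auto intro!: continuous_on_lipschitz_bound[of _ L])

lemma C11_pair_measurable:
  assumes "C11_pair a b L v P"
  shows "v \<in> borel_measurable borel" "P \<in> borel_measurable borel"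
  using C11_pair_continuous[OF assms] by (auto intro: borel_measurable_continuous_onI)

lemma C11_pair_integrable:
  assumes "C11_pair a b L v P"
  shows "integrable std_gaussian (\<lambda>z. v (x + r *\<^sub>R z))" "integrable std_gaussian (\<lambda>z. P (x + r *\<^sub>R z))"
proof -
  note [measurable] = C11_pair_measurable[OF assms]
  show "integrable std_gaussian (\<lambda>z. v (x + r *\<^sub>R z))"
    using C11_pairD[OF assms] by (intro integrable_std_gaussian_bounded[where B="\<bar>a\<bar> + \<bar>b\<bar>"]) auto
  show "integrable std_gaussian (\<lambda>z. P (x + r *\<^sub>R z))"
    using C11_pairD[OF assms] by (intro integrable_std_gaussian_bounded[where B=L]) auto
qed

text \<open>When \<open>g\<close> is not integrable its integral is 0 by convention, and
  \<open>h\<close> is nonnegative because it bounds norms.\<close>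

lemma norm_integral_std_gaussian_le:
  fixes g :: "real ^ 'n \<Rightarrow> 'b::{banach, second_countable_topology}"
  assumes h: "integrable std_gaussian h" and le: "\<And>z. norm (g z) \<le> h z"
  shows "norm (\<integral>z. g z \<partial>std_gaussian) \<le> (\<integral>z. h z \<partial>std_gaussian)"
proof (cases "integrable std_gaussian g")
  case True
  have "norm (\<integral>z. g z \<partial>std_gaussian) \<le> (\<integral>z. norm (g z) \<partial>std_gaussian)" by (rule integral_norm_bound)
  also have "\<dots> \<le> (\<integral>z. h z \<partial>std_gaussian)" using True h le by (intro integral_mono) auto
  finally show ?thesis .
next
  case False
  have "0 \<le> h z" for z using le[of z] norm_ge_zero order_trans by blast
  then show ?thesis using False by (simp add: not_integrable_integral_eq)
qed

lemma integral_std_gaussian_mem_Icc: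
  assumes "integrable std_gaussian g" "\<And>z. g z \<in> {a..b::real}"
  shows "(\<integral>z. g z \<partial>std_gaussian) \<in> {a..b}"
  using assms std_gaussian.integral_ge_const[of g a] std_gaussian.integral_le_const[of g b] by auto

text \<open>Each condition in \<open>C11_pair\<close> is convex in the pair and invariant under
  translations, so it passes to averages over translations with the same constants.\<close>

lemma C11_pair_gauss_avg:
  assumes A: "C11_pair a b L v P"
  shows "C11_pair a b L (gauss_avg r v) (gauss_avg r P)"
proof -
  note D = C11_pairD[OF A] and I = C11_pair_integrable[OF A]
  have 1: "gauss_avg r v x \<in> {a..b}" for x
    unfolding gauss_avg_def using I D by (intro integral_std_gaussian_mem_Icc) auto
  have 2: "norm (gauss_avg r P x) \<le> L" for x
    unfolding gauss_avg_def using norm_integral_std_gaussian_le[of "\<lambda>_. L" "\<lambda>z. P (x + r *\<^sub>R z)"] D by simp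
  have 3: "\<bar>gauss_avg r v y - gauss_avg r v x\<bar> \<le> L * norm (y - x)" for x y
    unfolding gauss_avg_def Bochner_Integration.integral_diff[OF I(1) I(1), symmetric]
    using norm_integral_std_gaussian_le[of "\<lambda>_. L * norm (y - x)" "\<lambda>z. v (y + r *\<^sub>R z) - v (x + r *\<^sub>R z)"]
      D(3)[of "y + r *\<^sub>R z" "x + r *\<^sub>R z" for z] by simp
  have 4: "norm (gauss_avg r P y - gauss_avg r P x) \<le> L * norm (y - x)" for x y
    unfolding gauss_avg_def Bochner_Integration.integral_diff[OF I(2) I(2), symmetric]
    using norm_integral_std_gaussian_le[of "\<lambda>_. L * norm (y - x)" "\<lambda>z. P (y + r *\<^sub>R z) - P (x + r *\<^sub>R z)"]
      D(4)[of "y + r *\<^sub>R z" "x + r *\<^sub>R z" for z] by simp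
  have 5: "\<bar>gauss_avg r v y - gauss_avg r v x - gauss_avg r P x \<bullet> (y - x)\<bar> \<le> L * (norm (y - x))\<^sup>2" for x y
  proof -
    have "gauss_avg r v y - gauss_avg r v x - gauss_avg r P x \<bullet> (y - x)
      = (\<integral>z. v (y + r *\<^sub>R z) - v (x + r *\<^sub>R z) - P (x + r *\<^sub>R z) \<bullet> (y - x) \<partial>std_gaussian)"
      unfolding gauss_avg_def by (simp add: I Bochner_Integration.integral_diff integral_inner_left)
    then show ?thesis
      using norm_integral_std_gaussian_le[of "\<lambda>_. L * (norm (y - x))\<^sup>2" "\<lambda>z. v (y + r *\<^sub>R z) - v (x + r *\<^sub>R z) - P (x + r *\<^sub>R z) \<bullet> (y - x)"]
        D(5)[of "y + r *\<^sub>R z" "x + r *\<^sub>R z" for z] by simp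
  qed
  show ?thesis unfolding C11_pair_def using 1 2 3 4 5 by blast
qed

text \<open>The deviation is the average of \<open>g z - g w\<close> over \<open>w\<close>, and the
  distance of \<open>z\<close> and \<open>w\<close> is at most
  \<open>norm z + norm w\<close>.\<close>

lemma deviation_from_mean_le:
  fixes g :: "real ^ 'n \<Rightarrow> 'b::{banach, second_countable_topology}"
  assumes g: "integrable std_gaussian g" and lip: "\<And>z w. norm (g z - g w) \<le> C * norm (z - w)" and C: "0 \<le> C"
  shows "norm (g z - (\<integral>w. g w \<partial>std_gaussian)) \<le> C * (norm z + (\<integral>w. norm w \<partial>(std_gaussian :: (real ^ 'n) measure)))"
proof -
  have n: "integrable std_gaussian (\<lambda>w :: real ^ 'n. norm w)"
    using integrable_std_gaussian_norm_power[of 1] by simp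
  have "g z - (\<integral>w. g w \<partial>std_gaussian) = (\<integral>w. g z - g w \<partial>std_gaussian)"
    using g by (simp add: Bochner_Integration.integral_diff)
  also have "norm \<dots> \<le> (\<integral>w. C * (norm z + norm w) \<partial>(std_gaussian :: (real ^ 'n) measure))"
  proof (rule norm_integral_std_gaussian_le)
    fix w
    show "norm (g z - g w) \<le> C * (norm z + norm w)"
      using lip[of z w] mult_left_mono[OF norm_triangle_ineq4[of z w] C] by linarith
  qed (use n in auto)
  also have "\<dots> = C * (norm z + (\<integral>w. norm w \<partial>(std_gaussian :: (real ^ 'n) measure)))"
    using n by simp
  finally show ?thesis .
qed

section \<open>One Gaussian step and its iteration\<close>

context concave_profile
begin

lemma bounded_N:
  obtains B where "\<And>p. p \<in> {a..b} \<times> {0..R} \<Longrightarrow> \<bar>N p\<bar> \<le> B"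
proof -
  have "compact (N ` ({a..b} \<times> {0..R}))"
    by (intro compact_continuous_image continuous_on_subset[OF continuous_N] compact_Times) auto
  then have "bounded (N ` ({a..b} \<times> {0..R}))" by (rule compact_imp_bounded)
  then show ?thesis using that by (auto simp: bounded_iff)
qed

lemma C11_pair_range:
  assumes "C11_pair a b L v P" "0 \<le> s" "s \<le> 1"
  shows "(v x, s * (norm (P x))\<^sup>2) \<in> {a..b} \<times> {0..L\<^sup>2}"
proof -
  have "s * (norm (P x))\<^sup>2 \<le> 1 * L\<^sup>2"
    using assms C11_pairD(2)[OF assms(1)] by (intro mult_mono power_mono) auto
  then show ?thesis using assms C11_pairD(1)[OF assms(1)] by simp
qed

lemma C11_pair_compose:
  assumes A: "C11_pair a b L v P" "0 \<le> s" "s \<le> 1"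
  shows "\<exists>B. \<forall>x. norm (N (v x, s * (norm (P x))\<^sup>2)) \<le> B"
    "(\<lambda>x. N (v x, s * (norm (P x))\<^sup>2)) \<in> borel_measurable borel"
proof -
  obtain B where B: "\<And>p. p \<in> {a..b} \<times> {0..L\<^sup>2} \<Longrightarrow> \<bar>N p\<bar> \<le> B" using bounded_N by blast
  then show "\<exists>B. \<forall>x. norm (N (v x, s * (norm (P x))\<^sup>2)) \<le> B"
    using C11_pair_range[OF A] by (metis real_norm_def)
  have "continuous_on UNIV (\<lambda>x. N (v x, s * (norm (P x))\<^sup>2))"
    using C11_pair_range[OF A] C11_pair_continuous[OF A(1)]
    by (intro continuous_on_compose2[OF continuous_N] continuous_intros) auto
  then show "(\<lambda>x. N (v x, s * (norm (P x))\<^sup>2)) \<in> borel_measurable borel"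
    by (rule borel_measurable_continuous_onI)
qed

text \<open>\<open>C\<close> is chosen before \<open>\<rho>\<close>, \<open>t\<close>,
  \<open>v\<close>, \<open>P\<close> and \<open>x\<close>, so one constant serves every step of the
  iteration. The second-order term is compensated by the change of time from \<open>t\<close> to
  \<open>t + \<rho>\<^sup>2\<close>, which leaves an error of third order.\<close>

lemma one_step:
  assumes L: "0 \<le> L"
  shows "\<exists>C. \<forall>\<rho> t. \<forall>v P. \<forall>x :: real ^ 'n. 0 < \<rho> \<longrightarrow> \<rho> \<le> 1 \<longrightarrow> 0 \<le> t \<longrightarrow> t + \<rho>\<^sup>2 \<le> 1 \<longrightarrow> C11_pair a b L v P \<longrightarrow>
    gauss_avg \<rho> (\<lambda>y. N (v y, (t + \<rho>\<^sup>2) * (norm (P y))\<^sup>2)) x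
      \<le> N (gauss_avg \<rho> v x, t * (norm (gauss_avg \<rho> P x))\<^sup>2) + C * \<rho> ^ 3"
proof -
  obtain K where K0: "K \<ge> 0" and K: "\<And>p q. p \<in> {a..b} \<times> {0..L\<^sup>2} \<Longrightarrow> q \<in> {a..b} \<times> {0..L\<^sup>2} \<Longrightarrow>
      \<bar>Nz p - Nz q\<bar> \<le> K * (\<bar>fst p - fst q\<bar> + \<bar>snd p - snd q\<bar>)"
    using Nz_lipschitz[of "L\<^sup>2"] by blast
  define m where "m k = (\<integral>z. norm z ^ k \<partial>(std_gaussian :: (real ^ 'n) measure))" for k :: nat
  have m0: "0 \<le> m k" for k unfolding m_def by simp
  have mI: "k \<le> 4 \<Longrightarrow> integrable std_gaussian (\<lambda>z :: real ^ 'n. norm z ^ k)" for k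
    by (rule integrable_std_gaussian_norm_power)
  define M3 where "M3 = (\<integral>z. (norm z + m 1) ^ 3 \<partial>(std_gaussian :: (real ^ 'n) measure))"
  have M3I: "integrable std_gaussian (\<lambda>z :: real ^ 'n. (norm z + m 1) ^ 3)"
  proof -
    have *: "(\<lambda>z :: real ^ 'n. (norm z + m 1) ^ 3) = (\<lambda>z. norm z ^ 3 + 3 * m 1 * norm z ^ 2 + 3 * (m 1)\<^sup>2 * norm z ^ 1 + m 1 ^ 3)"
      by (rule ext) (simp add: power3_eq_cube power2_eq_square algebra_simps)
    show ?thesis unfolding * by (intro Bochner_Integration.integrable_add integrable_mult_right mI) auto
  qed
  \<comment> \<open>\<open>C1\<close> measures by how much the variance of the averaged value may
    exceed its leading term, and \<open>K2\<close> bounds \<open>- Nz\<close>. The summands of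
    \<open>C\<close> come, in this order, from raising the time, from the variance, and from the
    Taylor remainder.\<close>
  define C1 where "C1 = 2 * L\<^sup>2 * m 1 + 2 * L\<^sup>2 * m 3 + L\<^sup>2 * m 4"
  define K2 where "K2 = \<bar>Nz (a, 0)\<bar> + K * (b - a + L\<^sup>2)"
  define C where "C = K * L ^ 4 + K2 * C1 + K * ((1 + 2 * L) * L ^ 3) * M3"
  have C1: "0 \<le> C1" using m0 by (simp add: C1_def)
  show ?thesis
  proof (intro exI[of _ C] allI impI)
    fix \<rho> t :: real and v and P :: "real ^ 'n \<Rightarrow> real ^ 'n" and x :: "real ^ 'n"
    assume \<rho>: "0 < \<rho>" "\<rho> \<le> 1" and t: "0 \<le> t" "t + \<rho>\<^sup>2 \<le> 1" and A: "C11_pair a b L v P"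
    note D = C11_pairD[OF A] and I = C11_pair_integrable[OF A, of x \<rho>]
    define s where "s = t + \<rho>\<^sup>2"
    \<comment> \<open>\<open>X\<close> and \<open>Y\<close> are the values of \<open>v\<close> and
      \<open>P\<close> after a Gaussian step from \<open>x\<close>. The expansion is made around
      their means \<open>x0\<close> and \<open>v0\<close>, so that its linear part integrates to
      zero.\<close>
    define X Y where "X z = v (x + \<rho> *\<^sub>R z)" and "Y z = P (x + \<rho> *\<^sub>R z)" for z
    define x0 v0 where "x0 = gauss_avg \<rho> v x" and "v0 = gauss_avg \<rho> P x"
    define p0 where "p0 = (x0, s * (norm v0)\<^sup>2)"
    define \<xi> \<eta> where "\<xi> z = X z - x0" and "\<eta> z = Y z - v0" for z
    note A' = C11_pair_gauss_avg[OF A, of \<rho>]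
    have s: "0 \<le> s" "s \<le> 1" using t \<rho> by (auto simp: s_def)
    have XI: "integrable std_gaussian X" and YI: "integrable std_gaussian Y" using I by (simp_all add: X_def[abs_def] Y_def[abs_def])
    have x0: "x0 = integral\<^sup>L std_gaussian X" "v0 = integral\<^sup>L std_gaussian Y"
      by (simp_all add: x0_def v0_def gauss_avg_def X_def[abs_def] Y_def[abs_def])
    have x0in: "x0 \<in> {a..b}" and v0L: "norm v0 \<le> L" using C11_pairD[OF A'] by (auto simp: x0_def v0_def)
    have p0in: "p0 \<in> {a..b} \<times> {0..L\<^sup>2}" using C11_pair_range[OF A' s, of x] by (simp add: p0_def x0_def v0_def)
    have \<rho>n: "norm ((x + \<rho> *\<^sub>R z) - (x + \<rho> *\<^sub>R w)) = \<rho> * norm (z - w)" for z w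
      using \<rho> by (simp add: scaleR_diff_right[symmetric])
    have \<xi>b: "\<bar>\<xi> z\<bar> \<le> L * \<rho> * (norm z + m 1)" for z
      using deviation_from_mean_le[OF XI, of "L * \<rho>" z] D(3)[of "x + \<rho> *\<^sub>R _" "x + \<rho> *\<^sub>R _"] L \<rho>
      unfolding \<rho>n by (simp add: \<xi>_def x0 X_def[abs_def] m_def mult.assoc)
    have \<eta>b: "norm (\<eta> z) \<le> L * \<rho> * (norm z + m 1)" for z
      using deviation_from_mean_le[OF YI, of "L * \<rho>" z] D(4)[of "x + \<rho> *\<^sub>R _" "x + \<rho> *\<^sub>R _"] L \<rho>
      unfolding \<rho>n by (simp add: \<eta>_def x0 Y_def[abs_def] m_def mult.assoc)
    have \<xi>I: "integrable std_gaussian \<xi>" and \<eta>I: "integrable std_gaussian \<eta>"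
      using XI YI by (simp_all add: \<xi>_def[abs_def] \<eta>_def[abs_def])
    have \<xi>0: "(\<integral>z. \<xi> z \<partial>std_gaussian) = 0" and \<eta>0: "(\<integral>z. \<eta> z \<partial>std_gaussian) = 0"
      using XI YI by (simp_all add: \<xi>_def \<eta>_def x0)
    have \<xi>2I: "integrable std_gaussian (\<lambda>z. (\<xi> z)\<^sup>2)"
    proof (rule integrable_std_gaussian_bounded[where B="(b - a)\<^sup>2"])
      show "(\<lambda>z. (\<xi> z)\<^sup>2) \<in> borel_measurable borel" using \<xi>I by (auto dest: borel_measurable_integrable)
      show "norm ((\<xi> z)\<^sup>2) \<le> (b - a)\<^sup>2" for z
      proof -
        have "\<bar>\<xi> z\<bar> \<le> \<bar>b - a\<bar>" using D(1)[of "x + \<rho> *\<^sub>R z"] x0in by (auto simp: \<xi>_def X_def)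
        then show ?thesis by (simp add: abs_le_square_iff)
      qed
    qed
    \<comment> \<open>\<open>segment_bound\<close> from the means to \<open>X z\<close> and
      \<open>Y z\<close>. Both increments are of order \<open>\<rho>\<close>, so the Lipschitz
      correction, multiplied by the square of \<open>\<xi> z\<close>, is of third order.\<close>
    have pw: "N (X z, s * (norm (Y z))\<^sup>2) \<le> N p0 + (Nx p0 * \<xi> z + Nz p0 * (2 * s * (v0 \<bullet> \<eta> z)))
       + (- Nz p0) * (\<xi> z)\<^sup>2 + (K * ((1 + 2 * L) * L ^ 3) * \<rho> ^ 3) * (norm z + m 1) ^ 3" for z
    proof -
      have "N (X z, s * (norm (Y z))\<^sup>2) \<le> N p0 + (Nx p0 * \<xi> z + Nz p0 * (2 * s * (v0 \<bullet> \<eta> z)))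
         + (- Nz p0 + K * (\<bar>\<xi> z\<bar> + 2 * L * norm (\<eta> z))) * (\<xi> z)\<^sup>2"
        unfolding \<xi>_def \<eta>_def p0_def using D
        by (intro segment_bound[OF x0in _ s v0L _ K0 K]) (auto simp: X_def Y_def)
      moreover have "K * (\<bar>\<xi> z\<bar> + 2 * L * norm (\<eta> z)) * (\<xi> z)\<^sup>2
         \<le> K * ((1 + 2 * L) * (L * \<rho> * (norm z + m 1))) * (L * \<rho> * (norm z + m 1))\<^sup>2"
      proof (intro mult_mono order_refl)
        have "2 * L * norm (\<eta> z) \<le> 2 * L * (L * \<rho> * (norm z + m 1))" using \<eta>b[of z] L by (intro mult_left_mono) auto
        then show "\<bar>\<xi> z\<bar> + 2 * L * norm (\<eta> z) \<le> (1 + 2 * L) * (L * \<rho> * (norm z + m 1))"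
          using \<xi>b[of z] by (simp add: distrib_right)
        show "(\<xi> z)\<^sup>2 \<le> (L * \<rho> * (norm z + m 1))\<^sup>2" using \<xi>b[of z] by (metis abs_ge_zero power2_abs power_mono)
      qed (use K0 L \<rho> m0 in auto)
      ultimately show ?thesis by (simp add: algebra_simps power2_eq_square power3_eq_cube)
    qed
    have "gauss_avg \<rho> (\<lambda>y. N (v y, s * (norm (P y))\<^sup>2)) x = (\<integral>z. N (X z, s * (norm (Y z))\<^sup>2) \<partial>std_gaussian)"
      by (simp add: gauss_avg_def X_def Y_def)
    also have "\<dots> \<le> (\<integral>z. N p0 + (Nx p0 * \<xi> z + Nz p0 * (2 * s * (v0 \<bullet> \<eta> z)))
       + (- Nz p0) * (\<xi> z)\<^sup>2 + (K * ((1 + 2 * L) * L ^ 3) * \<rho> ^ 3) * (norm z + m 1) ^ 3 \<partial>std_gaussian)"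
    proof (rule integral_mono[OF _ _ pw])
      obtain B where "\<And>x. norm (N (v x, s * (norm (P x))\<^sup>2)) \<le> B"
        using C11_pair_compose(1)[OF A s] by blast
      then show "integrable std_gaussian (\<lambda>z. N (X z, s * (norm (Y z))\<^sup>2))"
        unfolding X_def Y_def
        by (intro integrable_std_gaussian_bounded[where B=B] measurable_compose[OF _ C11_pair_compose(2)[OF A s]]) auto
      show "integrable std_gaussian (\<lambda>z. N p0 + (Nx p0 * \<xi> z + Nz p0 * (2 * s * (v0 \<bullet> \<eta> z)))
       + (- Nz p0) * (\<xi> z)\<^sup>2 + (K * ((1 + 2 * L) * L ^ 3) * \<rho> ^ 3) * (norm z + m 1) ^ 3)"
        by (intro Bochner_Integration.integrable_add integrable_mult_right integrable_inner_right \<xi>I \<eta>I \<xi>2I M3I) auto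
    qed
    also have "\<dots> = N p0 + (- Nz p0) * (\<integral>z. (\<xi> z)\<^sup>2 \<partial>std_gaussian) + (K * ((1 + 2 * L) * L ^ 3) * \<rho> ^ 3) * M3"
      using M3I by (simp add: \<xi>I \<eta>I \<xi>2I \<xi>0 \<eta>0 M3_def)
    finally have main: "gauss_avg \<rho> (\<lambda>y. N (v y, s * (norm (P y))\<^sup>2)) x
      \<le> N p0 + (- Nz p0) * (\<integral>z. (\<xi> z)\<^sup>2 \<partial>std_gaussian) + (K * ((1 + 2 * L) * L ^ 3) * \<rho> ^ 3) * M3" .
    \<comment> \<open>The variance is at most the mean square distance from \<open>v x\<close>. The
      first-order expansion of \<open>v\<close> at \<open>x\<close> bounds the latter by
      \<open>\<rho>\<^sup>2 * (norm (P x))\<^sup>2\<close> plus terms of order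
      \<open>\<rho> ^ 3\<close>.\<close>
    have var: "(\<integral>z. (\<xi> z)\<^sup>2 \<partial>std_gaussian) \<le> \<rho>\<^sup>2 * (norm v0)\<^sup>2 + C1 * \<rho> ^ 3"
    proof -
      have sq: "(X z - v x)\<^sup>2 \<le> \<rho>\<^sup>2 * (P x \<bullet> z)\<^sup>2 + (2 * L\<^sup>2 * \<rho> ^ 3) * norm z ^ 3 + (L\<^sup>2 * \<rho> ^ 3) * norm z ^ 4" for z
      proof -
        have "\<bar>X z - v x - \<rho> * (P x \<bullet> z)\<bar> \<le> L * (\<rho>\<^sup>2 * (norm z)\<^sup>2)"
          using D(5)[of "x + \<rho> *\<^sub>R z" x] \<rho> by (simp add: X_def power_mult_distrib)
        then have "\<bar>X z - v x\<bar> \<le> \<rho> * \<bar>P x \<bullet> z\<bar> + L * (\<rho>\<^sup>2 * (norm z)\<^sup>2)"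
          using \<rho> abs_mult[of \<rho> "P x \<bullet> z"] by simp
        then have "(X z - v x)\<^sup>2 \<le> (\<rho> * \<bar>P x \<bullet> z\<bar> + L * (\<rho>\<^sup>2 * (norm z)\<^sup>2))\<^sup>2"
          by (metis abs_ge_zero power2_abs power_mono)
        also have "\<dots> = \<rho>\<^sup>2 * (P x \<bullet> z)\<^sup>2 + 2 * L * \<rho> ^ 3 * (\<bar>P x \<bullet> z\<bar> * (norm z)\<^sup>2) + L\<^sup>2 * (\<rho> ^ 3 * \<rho>) * norm z ^ 4"
          by (simp add: power2_eq_square power3_eq_cube power4_eq_xxxx algebra_simps abs_mult_self_eq)
        also have "\<dots> \<le> \<rho>\<^sup>2 * (P x \<bullet> z)\<^sup>2 + 2 * L * \<rho> ^ 3 * ((L * norm z) * (norm z)\<^sup>2) + L\<^sup>2 * (\<rho> ^ 3 * 1) * norm z ^ 4"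
        proof (intro add_mono mult_mono order_refl)
          show "\<bar>P x \<bullet> z\<bar> \<le> L * norm z"
            using Cauchy_Schwarz_ineq2[of "P x" z] mult_right_mono[OF D(2)[of x], of "norm z"] by simp
        qed (use L \<rho> in auto)
        finally show ?thesis by (simp add: power2_eq_square power3_eq_cube algebra_simps)
      qed
      have "(\<integral>z. (\<xi> z)\<^sup>2 \<partial>std_gaussian) \<le> (\<integral>z. (\<xi> z)\<^sup>2 \<partial>std_gaussian) + (x0 - v x)\<^sup>2" by simp
      also have "\<dots> = (\<integral>z. (\<xi> z)\<^sup>2 + (2 * (x0 - v x)) * \<xi> z + (x0 - v x)\<^sup>2 \<partial>std_gaussian)"
        by (simp add: \<xi>I \<xi>2I \<xi>0)
      also have "\<dots> = (\<integral>z. (X z - v x)\<^sup>2 \<partial>std_gaussian)"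
        by (intro Bochner_Integration.integral_cong refl) (simp add: \<xi>_def power2_eq_square algebra_simps)
      also have "\<dots> \<le> (\<integral>z. \<rho>\<^sup>2 * (P x \<bullet> z)\<^sup>2 + (2 * L\<^sup>2 * \<rho> ^ 3) * norm z ^ 3 + (L\<^sup>2 * \<rho> ^ 3) * norm z ^ 4 \<partial>std_gaussian)"
      proof (rule integral_mono[OF _ _ sq])
        have "integrable std_gaussian (\<lambda>z. (\<xi> z)\<^sup>2 + (2 * (x0 - v x)) * \<xi> z + (x0 - v x)\<^sup>2)"
          by (intro Bochner_Integration.integrable_add integrable_mult_right \<xi>I \<xi>2I) auto
        also have "(\<lambda>z. (\<xi> z)\<^sup>2 + (2 * (x0 - v x)) * \<xi> z + (x0 - v x)\<^sup>2) = (\<lambda>z. (X z - v x)\<^sup>2)"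
          by (rule ext) (simp add: \<xi>_def power2_eq_square algebra_simps)
        finally show "integrable std_gaussian (\<lambda>z. (X z - v x)\<^sup>2)" .
        show "integrable std_gaussian (\<lambda>z. \<rho>\<^sup>2 * (P x \<bullet> z)\<^sup>2 + (2 * L\<^sup>2 * \<rho> ^ 3) * norm z ^ 3 + (L\<^sup>2 * \<rho> ^ 3) * norm z ^ 4)"
          by (intro Bochner_Integration.integrable_add integrable_mult_right std_gaussian_inner_square mI) auto
      qed
      also have "\<dots> = \<rho>\<^sup>2 * (norm (P x))\<^sup>2 + (2 * L\<^sup>2 * \<rho> ^ 3) * m 3 + (L\<^sup>2 * \<rho> ^ 3) * m 4"
        by (simp add: std_gaussian_inner_square mI m_def)
      \<comment> \<open>Passing from \<open>P x\<close> to the mean \<open>v0\<close> costs an error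
        of order \<open>\<rho>\<close>, which the factor \<open>\<rho>\<^sup>2\<close> in front
        turns into third order.\<close>
      also have "(norm (P x))\<^sup>2 \<le> (norm v0)\<^sup>2 + (2 * L\<^sup>2 * m 1) * \<rho>"
      proof -
        have "v0 - P x = (\<integral>z. Y z - P x \<partial>std_gaussian)" using YI by (simp add: x0)
        also have "norm \<dots> \<le> (\<integral>z. L * \<rho> * norm z ^ 1 \<partial>(std_gaussian :: (real ^ 'n) measure))"
          using D(4)[of "x + \<rho> *\<^sub>R _" x] \<rho> mI[of 1]
          by (intro norm_integral_std_gaussian_le) (auto simp: Y_def mult.assoc)
        also have "\<dots> = L * \<rho> * m 1" by (simp add: m_def)
        finally have d: "norm (P x) \<le> norm v0 + L * \<rho> * m 1"
          using norm_triangle_ineq2[of "P x" v0] by (simp add: norm_minus_commute)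
        have "(norm (P x))\<^sup>2 - (norm v0)\<^sup>2 = (norm (P x) - norm v0) * (norm (P x) + norm v0)"
          by (simp add: power2_eq_square algebra_simps)
        also have "\<dots> \<le> (L * \<rho> * m 1) * (L + L)"
        proof (cases "norm (P x) \<le> norm v0")
          case True
          then have "(norm (P x) - norm v0) * (norm (P x) + norm v0) \<le> 0" by (intro mult_nonpos_nonneg) auto
          moreover have "0 \<le> (L * \<rho> * m 1) * (L + L)" using L \<rho> m0 by simp
          ultimately show ?thesis by linarith
        next
          case False
          then show ?thesis using d v0L D(2)[of x] L \<rho> m0[of 1] by (intro mult_mono) auto
        qed
        finally show ?thesis by (simp add: power2_eq_square algebra_simps)
      qed
      finally show ?thesis
        using \<rho> by (simp add: C1_def power2_eq_square power3_eq_cube algebra_simps)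
    qed
    have K2: "- Nz p0 \<le> K2"
    proof -
      have "\<bar>Nz p0 - Nz (a, 0)\<bar> \<le> K * (\<bar>fst p0 - a\<bar> + \<bar>snd p0\<bar>)"
        using K[OF p0in, of "(a, 0)"] ab by simp
      also have "\<dots> \<le> K * (b - a + L\<^sup>2)" using p0in K0 by (intro mult_left_mono add_mono) auto
      finally show ?thesis unfolding K2_def by linarith
    qed
    \<comment> \<open>The mean value theorem for the change of time gives \<open>Nz\<close> at an
      intermediate point; moving that point to \<open>p0\<close> costs an error of order
      \<open>\<rho> ^ 4\<close>, and \<open>\<rho> \<le> 1\<close>.\<close>
    have inc: "N p0 \<le> N (x0, t * (norm v0)\<^sup>2) + \<rho>\<^sup>2 * (norm v0)\<^sup>2 * Nz p0 + K * L ^ 4 * \<rho> ^ 3"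
    proof -
      let ?z = "t * (norm v0)\<^sup>2"
      have sz: "s * (norm v0)\<^sup>2 = ?z + \<rho>\<^sup>2 * (norm v0)\<^sup>2" by (simp add: s_def algebra_simps)
      obtain \<zeta> where \<zeta>: "\<zeta> \<in> {?z..s * (norm v0)\<^sup>2}" "N p0 - N (x0, ?z) = (s * (norm v0)\<^sup>2 - ?z) * Nz (x0, \<zeta>)"
        unfolding p0_def using z_increment[OF x0in, of ?z "s * (norm v0)\<^sup>2"] t sz by (metis le_add_same_cancel1 mult_nonneg_nonneg zero_le_power2)
      have "\<bar>Nz (x0, \<zeta>) - Nz p0\<bar> \<le> K * (\<bar>fst (x0, \<zeta>) - fst p0\<bar> + \<bar>snd (x0, \<zeta>) - snd p0\<bar>)"
      proof (rule K[OF _ p0in])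
        have "0 \<le> ?z" using t by simp
        then show "(x0, \<zeta>) \<in> {a..b} \<times> {0..L\<^sup>2}" using \<zeta>(1) x0in p0in by (auto simp: p0_def)
      qed
      also have "\<dots> \<le> K * (\<rho>\<^sup>2 * (norm v0)\<^sup>2)"
        using \<zeta>(1) K0 sz by (intro mult_left_mono) (auto simp: p0_def)
      finally have "Nz (x0, \<zeta>) \<le> Nz p0 + K * (\<rho>\<^sup>2 * (norm v0)\<^sup>2)" by linarith
      then have "(\<rho>\<^sup>2 * (norm v0)\<^sup>2) * Nz (x0, \<zeta>) \<le> (\<rho>\<^sup>2 * (norm v0)\<^sup>2) * (Nz p0 + K * (\<rho>\<^sup>2 * (norm v0)\<^sup>2))"
        by (intro mult_left_mono) auto
      also have "\<dots> = \<rho>\<^sup>2 * (norm v0)\<^sup>2 * Nz p0 + K * norm v0 ^ 4 * (\<rho> ^ 3 * \<rho>)"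
        by (simp add: power2_eq_square power3_eq_cube power4_eq_xxxx algebra_simps)
      also have "\<dots> \<le> \<rho>\<^sup>2 * (norm v0)\<^sup>2 * Nz p0 + K * L ^ 4 * (\<rho> ^ 3 * 1)"
        using K0 \<rho> v0L L by (intro add_mono mult_mono power_mono order_refl) auto
      finally show ?thesis using \<zeta>(2) sz by simp
    qed
    have neg: "0 \<le> - Nz p0" using Nz_nonpos[of p0] p0in by auto
    \<comment> \<open>The leading term \<open>- (\<rho>\<^sup>2 * (norm v0)\<^sup>2 * Nz p0)\<close>
      obtained here cancels against the one in \<open>inc\<close>.\<close>
    have "(- Nz p0) * (\<integral>z. (\<xi> z)\<^sup>2 \<partial>std_gaussian) \<le> (- Nz p0) * (\<rho>\<^sup>2 * (norm v0)\<^sup>2 + C1 * \<rho> ^ 3)"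
      using var neg by (rule mult_left_mono)
    also have "\<dots> = (- Nz p0) * (\<rho>\<^sup>2 * (norm v0)\<^sup>2) + (- Nz p0) * (C1 * \<rho> ^ 3)" by (simp only: distrib_left)
    also have "(- Nz p0) * (C1 * \<rho> ^ 3) \<le> K2 * (C1 * \<rho> ^ 3)"
      using K2 C1 \<rho> by (intro mult_right_mono) auto
    finally have "(- Nz p0) * (\<integral>z. (\<xi> z)\<^sup>2 \<partial>std_gaussian) \<le> - (\<rho>\<^sup>2 * (norm v0)\<^sup>2 * Nz p0) + K2 * C1 * \<rho> ^ 3"
      by (simp add: algebra_simps)
    then show "gauss_avg \<rho> (\<lambda>y. N (v y, (t + \<rho>\<^sup>2) * (norm (P y))\<^sup>2)) x
      \<le> N (gauss_avg \<rho> v x, t * (norm (gauss_avg \<rho> P x))\<^sup>2) + C * \<rho> ^ 3"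
      using main inc unfolding C_def s_def[symmetric] x0_def[symmetric] v0_def[symmetric] distrib_right
      by (simp add: mult.commute mult.left_commute)
  qed
qed


lemma gauss_avg_mono:
  assumes "g \<in> borel_measurable borel" "\<And>x. norm (g x) \<le> B" "h \<in> borel_measurable borel" "\<And>x. norm (h x) \<le> B'"
    and "\<And>x. g x \<le> (h x :: real)"
  shows "gauss_avg r g x \<le> gauss_avg r h x"
  unfolding gauss_avg_def using assms
  by (intro integral_mono integrable_std_gaussian_bounded[where B=B] integrable_std_gaussian_bounded[where B=B']) auto

lemma gauss_avg_bounded:
  assumes g[measurable]: "g \<in> borel_measurable borel" and "\<And>x. norm (g x) \<le> B"
  shows "gauss_avg r g \<in> borel_measurable borel" "norm (gauss_avg r g x) \<le> B"
proof -
  show "gauss_avg r g \<in> borel_measurable borel" unfolding gauss_avg_def by measurable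
  show "norm (gauss_avg r g x) \<le> B"
    unfolding gauss_avg_def using norm_integral_std_gaussian_le[of "\<lambda>_. B" "\<lambda>z. g (x + r *\<^sub>R z)"] assms(2) by simp
qed

text \<open>The interpolation is cut into \<open>m\<close> Gaussian steps of variance
  \<open>1 / m\<close>. Since \<open>m * \<rho>\<^sup>2 = 1\<close>, the \<open>m\<close> errors
  \<open>C * \<rho> ^ 3\<close> add up to \<open>C * \<rho>\<close>, which tends to zero.\<close>

lemma gaussian_inequality_C11:
  fixes f :: "real ^ 'n \<Rightarrow> real"
  assumes A: "C11_pair a b L f P"
  shows "(\<integral>x. N (f x, (norm (P x))\<^sup>2) \<partial>std_gaussian) \<le> N (\<integral>x. f x \<partial>std_gaussian, 0)"
proof -
  have L: "0 \<le> L" by (rule C11_pairD(6)[OF A])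
  obtain C where C: "\<And>\<rho> t v P x. 0 < \<rho> \<Longrightarrow> \<rho> \<le> 1 \<Longrightarrow> 0 \<le> t \<Longrightarrow> t + \<rho>\<^sup>2 \<le> 1 \<Longrightarrow> C11_pair a b L v P \<Longrightarrow>
    gauss_avg \<rho> (\<lambda>y. N (v y, (t + \<rho>\<^sup>2) * (norm (P y))\<^sup>2)) (x :: real ^ 'n)
      \<le> N (gauss_avg \<rho> v x, t * (norm (gauss_avg \<rho> P x))\<^sup>2) + C * \<rho> ^ 3"
    using one_step[OF L, where 'n='n] by blast
  have approx: "(\<integral>x. N (f x, (norm (P x))\<^sup>2) \<partial>std_gaussian) \<le> N (\<integral>x. f x \<partial>std_gaussian, 0) + C * sqrt (1 / Suc m')" for m'
  proof -
    define m where "m = Suc m'"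
    define \<rho> where "\<rho> = sqrt (1 / m)"
    have \<rho>: "0 < \<rho>" "\<rho> \<le> 1" "\<rho>\<^sup>2 = 1 / m" by (simp_all add: \<rho>_def m_def)
    \<comment> \<open>For \<open>j \<le> m\<close> the square of \<open>\<tau> j\<close> is
      \<open>1 - j / m\<close>, the variance still averaged out at time \<open>j / m\<close>. Thus
      \<open>V 0\<close> at the origin is the mean of \<open>f\<close>, while \<open>V m\<close> and
      \<open>W m\<close> are \<open>f\<close> and \<open>P\<close>.\<close>
    define \<tau> where "\<tau> j = sqrt (real (m - j) / m)" for j
    define V W where "V j = gauss_avg (\<tau> j) f" and "W j = gauss_avg (\<tau> j) P" for j
    define Q where "Q j x = N (V j x, j / m * (norm (W j x))\<^sup>2)" for j x
    have A': "C11_pair a b L (V j) (W j)" for j unfolding V_def W_def by (rule C11_pair_gauss_avg[OF A])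
    have jm: "0 \<le> j / m" "j \<le> m \<Longrightarrow> j / m \<le> 1" for j by (simp_all add: m_def)
    have Qm: "Q j \<in> borel_measurable borel" and QB: "\<exists>B. \<forall>x. norm (Q j x) \<le> B" if "j \<le> m" for j
      unfolding Q_def using C11_pair_compose[OF A' jm(1) jm(2)[OF that], of j] by blast+
    have step: "gauss_avg \<rho> (Q (Suc j)) x \<le> Q j x + C * \<rho> ^ 3" if j: "j < m" for j x
    proof -
      have s: "(Suc j) / m = j / m + \<rho>\<^sup>2" by (simp add: \<rho> add_divide_distrib)
      have \<tau>: "(\<tau> j)\<^sup>2 = \<rho>\<^sup>2 + (\<tau> (Suc j))\<^sup>2" "0 \<le> \<tau> j"
        using j by (simp_all add: \<tau>_def \<rho> add_divide_distrib[symmetric])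
      have V: "gauss_avg \<rho> (V (Suc j)) x = V j x"
        unfolding V_def using C11_pairD(7)[OF A] \<rho> \<tau> C11_pair_measurable(1)[OF A]
        by (intro gauss_avg_gauss_avg[where B="\<bar>a\<bar> + \<bar>b\<bar>"]) auto
      have W: "gauss_avg \<rho> (W (Suc j)) x = W j x"
        unfolding W_def using C11_pairD(2)[OF A] \<rho> \<tau> C11_pair_measurable(2)[OF A]
        by (intro gauss_avg_gauss_avg[where B=L]) auto
      have "j / m + \<rho>\<^sup>2 \<le> 1" using jm(2)[of "Suc j"] j unfolding s by simp
      from C[OF \<rho>(1,2) jm(1) this A'[of "Suc j"], of x]
      show ?thesis unfolding Q_def s V W .
    qed
    \<comment> \<open>The average at the origin with standard deviation \<open>sqrt (j / m)\<close>
      is the mean over the position at time \<open>j / m\<close>. The semigroup law splits off the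
      last step of variance \<open>\<rho>\<^sup>2\<close>.\<close>
    have iter: "gauss_avg (sqrt (j / m)) (Q j) 0 \<le> Q 0 0 + j * (C * \<rho> ^ 3)" if "j \<le> m" for j
      using that
    proof (induction j)
      case (Suc j)
      obtain B where B: "\<And>x. norm (Q (Suc j) x) \<le> B" using QB Suc.prems by blast
      obtain B' where B': "\<And>x. norm (Q j x) \<le> B'" using QB[of j] Suc.prems by auto
      have Qj: "Q j \<in> borel_measurable borel" using Qm[of j] Suc.prems by simp
      have "gauss_avg (sqrt (Suc j / m)) (Q (Suc j)) 0 = gauss_avg (sqrt (j / m)) (gauss_avg \<rho> (Q (Suc j))) 0"
        using Qm[OF Suc.prems] B \<rho> by (intro gauss_avg_gauss_avg[symmetric, where B=B]) (auto simp: add_divide_distrib)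
      also have "\<dots> \<le> gauss_avg (sqrt (j / m)) (\<lambda>x. Q j x + C * \<rho> ^ 3) 0"
      proof (rule gauss_avg_mono)
        show "gauss_avg \<rho> (Q (Suc j)) \<in> borel_measurable borel" "\<And>x. norm (gauss_avg \<rho> (Q (Suc j)) x) \<le> B"
          using gauss_avg_bounded[OF Qm[OF Suc.prems] B] by auto
        show "norm (Q j x + C * \<rho> ^ 3) \<le> B' + \<bar>C * \<rho> ^ 3\<bar>" for x
          using B'[of x] norm_triangle_ineq[of "Q j x" "C * \<rho> ^ 3"] by simp
      qed (use step Suc.prems Qj in auto)
      also have "\<dots> = gauss_avg (sqrt (j / m)) (Q j) 0 + C * \<rho> ^ 3"
        unfolding gauss_avg_def using Qj B'
        by (subst Bochner_Integration.integral_add) (auto intro!: integrable_std_gaussian_bounded[where B=B'])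
      finally show ?case using Suc by (simp add: algebra_simps)
    qed simp
    have mC: "m * (C * \<rho> ^ 3) = C * \<rho>"
      using \<rho> by (simp add: power3_eq_cube power2_eq_square m_def field_simps)
    have "V m = f" "W m = P" by (simp_all add: V_def W_def \<tau>_def)
    then have Qm': "Q m = (\<lambda>x. N (f x, (norm (P x))\<^sup>2))" by (auto simp: Q_def m_def)
    have Q0: "Q 0 0 = N (\<integral>x. f x \<partial>std_gaussian, 0)" by (simp add: Q_def V_def \<tau>_def m_def gauss_avg_def)
    have m1: "sqrt (m / m) = 1" by (simp add: m_def)
    have "gauss_avg 1 (Q m) 0 \<le> Q 0 0 + C * \<rho>" using iter[of m] unfolding mC m1 by simp
    then show ?thesis unfolding Qm' Q0 by (simp add: gauss_avg_def \<rho>_def m_def)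
  qed
  have lim: "(\<lambda>m. N (\<integral>x. f x \<partial>std_gaussian, 0) + C * sqrt (1 / Suc m)) \<longlonglongrightarrow> N (\<integral>x. f x \<partial>std_gaussian, 0) + C * sqrt 0"
    by (intro tendsto_intros LIMSEQ_inverse_real_of_nat[unfolded inverse_eq_divide])
  show ?thesis
    using LIMSEQ_le_const[OF lim] approx by simp
qed

end

section \<open>Approximation of smooth functions\<close>

text \<open>For \<open>k > 0\<close> a smooth increasing contraction with values in a bounded
  interval, tending to the identity as \<open>k\<close> grows.\<close>

definition squash :: "real \<Rightarrow> real \<Rightarrow> real" where
  "squash k t = k * arctan (t / k)"

text \<open>The density of the image of the Gaussian measure under \<^term>\<open>squash k\<close> with respect to it.\<close>

definition squash_density :: "real \<Rightarrow> real \<Rightarrow> real" where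
  "squash_density k s = (if \<bar>s\<bar> < k * (pi / 2)
     then exp ((s\<^sup>2 - (k * tan (s / k))\<^sup>2) / 2) * (1 + (tan (s / k))\<^sup>2) else 0)"

lemma squash_range: "k > 0 \<Longrightarrow> \<bar>squash k t\<bar> < k * (pi / 2)"
  using arctan_bounded[of "t / k"] by (auto simp: squash_def abs_mult abs_less_iff)

lemma squash_density_squash:
  assumes "k > 0"
  shows "squash_density k (squash k t) = exp (((squash k t)\<^sup>2 - t\<^sup>2) / 2) * (1 + (t / k)\<^sup>2)"
proof -
  have "squash k t / k = arctan (t / k)" using assms by (simp add: squash_def)
  then show ?thesis using squash_range[OF assms, of t] assms by (simp add: squash_density_def tan_arctan)
qed

lemma squash_surj:
  assumes "k > 0" "\<bar>s\<bar> < k * (pi / 2)"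
  shows "squash k (k * tan (s / k)) = s"
proof -
  have "- (pi / 2) < s / k" "s / k < pi / 2" using assms by (auto simp: field_simps abs_less_iff)
  then show ?thesis using assms by (simp add: squash_def arctan_tan)
qed

lemma squash_has_derivative:
  assumes "k > 0"
  shows "(squash k has_field_derivative 1 / (1 + (t / k)\<^sup>2)) (at t within S)"
  unfolding squash_def[abs_def] using assms
  by (auto intro!: derivative_eq_intros simp: divide_inverse)

lemma squash_lipschitz:
  assumes "k > 0"
  shows "\<bar>squash k s - squash k t\<bar> \<le> \<bar>s - t\<bar>"
proof -
  have "norm (squash k s - squash k t) \<le> 1 * norm (s - t)"
  proof (rule field_differentiable_bound[OF convex_UNIV squash_has_derivative[OF assms]])
    show "norm (1 / (1 + (x / k)\<^sup>2)) \<le> 1" for x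
      by (simp add: divide_le_eq add_nonneg_nonneg add_pos_nonneg)
  qed auto
  then show ?thesis by simp
qed

lemma squash_measurable[measurable]: "squash k \<in> borel_measurable borel"
  unfolding squash_def[abs_def] by measurable

lemma squash_density_nonneg: "0 \<le> squash_density k s"
  by (simp add: squash_density_def add_nonneg_nonneg)

lemma squash_density_measurable[measurable]: "squash_density k \<in> borel_measurable borel"
  unfolding squash_density_def[abs_def] tan_def by measurable

text \<open>With \<open>\<tau> = tan (s / k)\<close> the exponent is
  \<open>- k\<^sup>2 * (\<tau>\<^sup>2 - (arctan \<tau>)\<^sup>2) / 2\<close>. Since
  \<open>k \<ge> 1\<close> and the arctangent is bounded by \<open>pi / 2\<close>, the density is at
  most \<open>exp (pi\<^sup>2 / 8) * exp (- (\<tau>\<^sup>2 / 2)) * (1 + \<tau>\<^sup>2)\<close>,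
  where the last two factors have product at most 2.\<close>

lemma squash_density_bound:
  assumes k: "k \<ge> 1"
  shows "squash_density k s \<le> 2 * exp (pi\<^sup>2 / 8)"
proof (cases "\<bar>s\<bar> < k * (pi / 2)")
  case True
  define \<tau> where "\<tau> = tan (s / k)"
  have k0: "k > 0" using k by simp
  have s: "s = squash k (k * \<tau>)" using squash_surj[OF k0 True] by (simp add: \<tau>_def)
  have sk: "s = k * arctan \<tau>" using s k0 by (simp add: squash_def)
  have abs_le: "\<bar>arctan \<tau>\<bar> \<le> \<bar>\<tau>\<bar>" using squash_lipschitz[of 1 \<tau> 0] by (simp add: squash_def)
  then have sq_le: "(arctan \<tau>)\<^sup>2 \<le> \<tau>\<^sup>2" by (simp add: abs_le_square_iff)
  have "\<bar>arctan \<tau>\<bar> \<le> \<bar>pi / 2\<bar>" using arctan_bounded[of \<tau>] by linarith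
  then have pi_le: "(arctan \<tau>)\<^sup>2 \<le> (pi / 2)\<^sup>2" by (simp only: abs_le_square_iff)
  have "1 * (\<tau>\<^sup>2 - (arctan \<tau>)\<^sup>2) \<le> k\<^sup>2 * (\<tau>\<^sup>2 - (arctan \<tau>)\<^sup>2)"
    using sq_le k by (intro mult_right_mono) auto
  then have "(s\<^sup>2 - (k * \<tau>)\<^sup>2) / 2 \<le> pi\<^sup>2 / 8 - \<tau>\<^sup>2 / 2"
  proof -
    assume *: "1 * (\<tau>\<^sup>2 - (arctan \<tau>)\<^sup>2) \<le> k\<^sup>2 * (\<tau>\<^sup>2 - (arctan \<tau>)\<^sup>2)"
    have "s\<^sup>2 - (k * \<tau>)\<^sup>2 = - (k\<^sup>2 * (\<tau>\<^sup>2 - (arctan \<tau>)\<^sup>2))" by (simp add: sk power_mult_distrib algebra_simps)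
    then show ?thesis using * pi_le by (simp add: power_divide)
  qed
  then have "exp ((s\<^sup>2 - (k * \<tau>)\<^sup>2) / 2) \<le> exp (pi\<^sup>2 / 8 - \<tau>\<^sup>2 / 2)" by simp
  also have "\<dots> = exp (pi\<^sup>2 / 8) * exp (- (\<tau>\<^sup>2 / 2))" by (simp add: exp_add[symmetric])
  finally have e: "exp ((s\<^sup>2 - (k * \<tau>)\<^sup>2) / 2) \<le> exp (pi\<^sup>2 / 8) * exp (- (\<tau>\<^sup>2 / 2))" .
  have "1 + \<tau>\<^sup>2 \<le> 2 * exp (\<tau>\<^sup>2 / 2)" using exp_ge_add_one_self[of "\<tau>\<^sup>2 / 2"] by linarith
  then have "exp ((s\<^sup>2 - (k * \<tau>)\<^sup>2) / 2) * (1 + \<tau>\<^sup>2) \<le> (exp (pi\<^sup>2 / 8) * exp (- (\<tau>\<^sup>2 / 2))) * (2 * exp (\<tau>\<^sup>2 / 2))"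
    using e by (intro mult_mono) auto
  also have "\<dots> = 2 * exp (pi\<^sup>2 / 8)" by (simp add: exp_minus)
  finally show ?thesis using True by (simp add: squash_density_def \<tau>_def)
qed (simp add: squash_density_def)

lemma squash_density_tendsto: "(\<lambda>n. squash_density (real (Suc n)) s) \<longlonglongrightarrow> 1"
proof -
  have u: "(\<lambda>n. s / real (Suc n)) \<longlonglongrightarrow> 0" by real_asymp
  have T: "(\<lambda>n. tan (s / real (Suc n))) \<longlonglongrightarrow> 0"
    using isCont_tendsto_compose[OF isCont_tan u] by simp
  \<comment> \<open>For nonzero \<open>s\<close> this is the difference quotient of the tangent at
    0, whose limit is 1, multiplied by \<open>s\<close>.\<close>
  have kT: "(\<lambda>n. real (Suc n) * tan (s / real (Suc n))) \<longlonglongrightarrow> s"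
  proof (cases "s = 0")
    case False
    have "((\<lambda>h. tan h / h) \<longlongrightarrow> 1) (at 0)"
      using DERIV_tan[of 0] by (simp add: DERIV_def)
    then have "(\<lambda>n. tan (s / real (Suc n)) / (s / real (Suc n))) \<longlonglongrightarrow> 1"
      by (rule filterlim_compose) (use u False in \<open>auto simp: filterlim_at\<close>)
    then have "(\<lambda>n. s * (tan (s / real (Suc n)) / (s / real (Suc n)))) \<longlonglongrightarrow> s * 1"
      by (intro tendsto_mult tendsto_const)
    then show ?thesis using False by (simp add: mult.commute)
  qed simp
  have "(\<lambda>n. exp ((s\<^sup>2 - (real (Suc n) * tan (s / real (Suc n)))\<^sup>2) / 2) * (1 + (tan (s / real (Suc n)))\<^sup>2))
     \<longlonglongrightarrow> exp ((s\<^sup>2 - s\<^sup>2) / 2) * (1 + 0\<^sup>2)"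
    by (intro tendsto_intros T kT) auto
  moreover have "eventually (\<lambda>n. \<bar>s\<bar> < real (Suc n) * (pi / 2)) sequentially"
    by real_asymp
  then have "eventually (\<lambda>n. exp ((s\<^sup>2 - (real (Suc n) * tan (s / real (Suc n)))\<^sup>2) / 2) * (1 + (tan (s / real (Suc n)))\<^sup>2)
     = squash_density (real (Suc n)) s) sequentially"
    by eventually_elim (simp add: squash_density_def)
  ultimately show ?thesis by (auto intro: Lim_transform_eventually)
qed

text \<open>The substitution \<open>s = squash k t\<close>. The factor
  \<open>1 + (tan (s / k))\<^sup>2\<close> of the density cancels the derivative of
  \<open>squash k\<close>, and its exponential trades the Gaussian weight at \<open>s\<close> for
  the one at \<open>t\<close>.\<close>

lemma distr_squash:
  assumes k: "k > 0"
  shows "distr std_normal borel (squash k) = density std_normal (squash_density k)"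
proof (rule measure_eqI)
  fix A assume "A \<in> sets (distr std_normal borel (squash k))"
  then have [measurable]: "A \<in> sets borel" by simp
  define F where "F s = indicator A s * (squash_density k s * std_normal_density s)" for s :: real
  have [measurable]: "F \<in> borel_measurable borel" unfolding F_def by measurable
  have F0: "0 \<le> F s" for s by (simp add: F_def squash_density_nonneg)
  have pull: "\<bar>1 / (1 + (t / k)\<^sup>2)\<bar> * F (squash k t) = indicator A (squash k t) * std_normal_density t" for t
  proof -
    define q where "q = 1 + (t / k)\<^sup>2"
    have q: "q > 0" by (simp add: q_def add_pos_nonneg)
    have e: "exp (((squash k t)\<^sup>2 - t\<^sup>2) / 2) * exp (- (squash k t)\<^sup>2 / 2) = exp (- t\<^sup>2 / 2)"
      by (simp add: exp_add[symmetric] diff_divide_distrib)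
    have "\<bar>1 / q\<bar> * F (squash k t) = indicator A (squash k t) *
        (1 / sqrt (2 * pi) * (exp (((squash k t)\<^sup>2 - t\<^sup>2) / 2) * exp (- (squash k t)\<^sup>2 / 2)))"
      using q unfolding F_def squash_density_squash[OF k] q_def[symmetric] std_normal_density_def by simp
    then show ?thesis unfolding e q_def[symmetric] std_normal_density_def .
  qed
  have inj: "inj (squash k)"
    by (rule injI) (use k in \<open>simp add: squash_def arctan_eq_iff\<close>)
  have I1: "integrable lborel (\<lambda>t. indicator A (squash k t) * std_normal_density t)"
    by (rule Bochner_Integration.integrable_bound[OF integrable_std_normal_moment[of 0]])
       (auto simp: indicator_def)
  have "(\<lambda>t. \<bar>1 / (1 + (t / k)\<^sup>2)\<bar> * F (squash k t)) absolutely_integrable_on UNIV"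
    unfolding pull absolutely_integrable_on_def[symmetric] using I1
    by (simp add: set_integrable_def integrable_completion)
  then have abs: "F absolutely_integrable_on (squash k ` UNIV)"
    and int: "integral (squash k ` UNIV) F = integral UNIV (\<lambda>t. \<bar>1 / (1 + (t / k)\<^sup>2)\<bar> * F (squash k t))"
    using has_absolute_integral_change_of_variables_1'[of UNIV "squash k" "\<lambda>t. 1 / (1 + (t / k)\<^sup>2)" F]
      squash_has_derivative[OF k] inj by auto
  \<comment> \<open>The density is 0 off the range of \<open>squash k\<close>, so integrals of
    \<open>F\<close> over that range are integrals over the whole line.\<close>
  have out: "F s = 0" if "s \<notin> squash k ` UNIV" for s
  proof -
    have "\<not> \<bar>s\<bar> < k * (pi / 2)" using squash_surj[OF k, of s] that by (metis rangeI)
    then show ?thesis by (simp add: F_def squash_density_def)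
  qed
  have ind: "indicator (squash k ` UNIV) s * F s = F s" for s using out[of s] by (auto simp: indicator_def)
  have I2: "integrable lborel F"
    using abs by (simp add: set_integrable_def ind integrable_completion)
  have "integral (squash k ` UNIV) F = integral\<^sup>L lborel F"
    using set_lebesgue_integral_eq_integral(2)[OF abs]
    by (simp add: set_lebesgue_integral_def ind integral_completion)
  moreover have "integral UNIV (\<lambda>t. \<bar>1 / (1 + (t / k)\<^sup>2)\<bar> * F (squash k t)) = integral\<^sup>L lborel (\<lambda>t. indicator A (squash k t) * std_normal_density t)"
    unfolding pull using I1 by (rule integral_lborel)
  ultimately have eq: "integral\<^sup>L lborel (\<lambda>t. indicator A (squash k t) * std_normal_density t) = integral\<^sup>L lborel F"
    using int by simp
  have "emeasure (distr std_normal borel (squash k)) A = (\<integral>\<^sup>+t. indicator A (squash k t) * ennreal (std_normal_density t) \<partial>lborel)"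
    by (subst nn_integral_indicator[symmetric], simp) (simp add: nn_integral_distr nn_integral_density mult.commute del: nn_integral_indicator)
  also have "\<dots> = (\<integral>\<^sup>+t. ennreal (indicator A (squash k t) * std_normal_density t) \<partial>lborel)"
    by (intro nn_integral_cong) (auto simp: indicator_def)
  also have "\<dots> = ennreal (integral\<^sup>L lborel F)"
    unfolding eq[symmetric] by (intro nn_integral_eq_integral I1) auto
  also have "\<dots> = (\<integral>\<^sup>+s. ennreal (F s) \<partial>lborel)"
    using F0 by (intro nn_integral_eq_integral[symmetric] I2) auto
  also have "\<dots> = (\<integral>\<^sup>+s. ennreal (std_normal_density s) * (ennreal (squash_density k s) * indicator A s) \<partial>lborel)"
    by (intro nn_integral_cong) (auto simp: F_def indicator_def ennreal_mult'[symmetric] squash_density_nonneg mult.commute)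
  also have "\<dots> = emeasure (density std_normal (squash_density k)) A"
    by (subst emeasure_density) (auto simp: nn_integral_density)
  finally show "emeasure (distr std_normal borel (squash k)) A = emeasure (density std_normal (squash_density k)) A" .
qed simp

definition squash_vec :: "real \<Rightarrow> real ^ 'n \<Rightarrow> real ^ 'n" where
  "squash_vec k x = vec_of (\<lambda>b. squash k (x \<bullet> b))"

lemma squash_vec_inner: "b \<in> Basis \<Longrightarrow> squash_vec k x \<bullet> b = squash k (x \<bullet> b)"
  unfolding squash_vec_def by (rule vec_of_inner)

lemma squash_vec_measurable[measurable]: "squash_vec k \<in> borel_measurable borel"
  unfolding squash_vec_def[abs_def] by measurable

text \<open>The image of a product measure under a coordinatewise map is the product of the images.
  Each of these has density \<open>squash_density k\<close>, and \<open>PiM_density\<close> collects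
  them into one product density.\<close>

lemma integral_squash_vec:
  fixes h :: "real ^ 'n \<Rightarrow> real"
  assumes k: "k > 0" and [measurable]: "h \<in> borel_measurable borel"
  shows "(\<integral>x. h (squash_vec k x) \<partial>std_gaussian) = (\<integral>x. (\<Prod>b\<in>Basis. squash_density k (x \<bullet> b)) * h x \<partial>std_gaussian)"
proof -
  interpret N: prob_space std_normal by (rule prob_space_std_normal)
  interpret P: product_sigma_finite "\<lambda>_ :: real ^ 'n. std_normal" by standard
  let ?D = "distr std_normal borel (squash k)"
  let ?P = "\<lambda>\<mu>. PiM (Basis :: (real ^ 'n) set) (\<lambda>_. \<mu> :: real measure)"
  interpret D: prob_space ?D by (rule N.prob_space_distr) simp
  have "distr std_normal std_normal (squash k) = ?D" by (rule distr_cong) auto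
  then have PD: "distr (?P std_normal) (?P std_normal) (compose Basis (squash k)) = ?P ?D"
    using distr_PiM_finite_prob_space'[of "Basis :: (real ^ 'n) set" "\<lambda>_. std_normal" "\<lambda>_. std_normal" "squash k"]
    by (simp add: prob_space_std_normal)
  have PD': "density (?P std_normal) (\<lambda>g. \<Prod>b\<in>Basis. ennreal (squash_density k (g b))) = ?P ?D"
    unfolding distr_squash[OF k]
    by (rule PiM_density) (auto intro: N.sigma_finite_measure_axioms D.sigma_finite_measure_axioms[unfolded distr_squash[OF k]])
  have [measurable]: "compose Basis (squash k) \<in> measurable (?P std_normal) (?P std_normal)"
    unfolding compose_def by measurable
  have "(\<integral>x. h (squash_vec k x) \<partial>std_gaussian) = (\<integral>g. h (squash_vec k (vec_of g)) \<partial>?P std_normal)"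
    unfolding std_gaussian_eq_distr_PiM by (subst integral_distr) auto
  also have "\<dots> = (\<integral>g. h (vec_of (compose Basis (squash k) g)) \<partial>?P std_normal)"
    by (intro Bochner_Integration.integral_cong refl arg_cong[where f=h])
       (auto simp: squash_vec_def vec_of_inner compose_def intro!: sum.cong)
  also have "\<dots> = (\<integral>g. h (vec_of g) \<partial>?P ?D)"
    by (subst PD[symmetric], subst integral_distr) auto
  also have "\<dots> = (\<integral>g. (\<Prod>b\<in>Basis. squash_density k (g b)) * h (vec_of g) \<partial>?P std_normal)"
    unfolding PD'[symmetric]
    by (subst prod_ennreal, simp add: squash_density_nonneg, subst integral_density) (auto intro!: prod_nonneg squash_density_nonneg)
  also have "\<dots> = (\<integral>x. (\<Prod>b\<in>Basis. squash_density k (x \<bullet> b)) * h x \<partial>std_gaussian)"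
    unfolding std_gaussian_eq_distr_PiM by (subst integral_distr) (auto simp: vec_of_inner)
  finally show ?thesis .
qed

text \<open>Moving the dependence on \<open>n\<close> from the argument of \<open>h\<close> into a
  density gives pointwise convergence for any integrable \<open>h\<close>. A power of the uniform
  bound on the one-dimensional densities provides the dominating function.\<close>

lemma integral_squash_vec_tendsto:
  fixes h :: "real ^ 'n \<Rightarrow> real"
  assumes h: "integrable std_gaussian h"
  shows "(\<lambda>n. \<integral>x. h (squash_vec (real (Suc n)) x) \<partial>std_gaussian) \<longlonglongrightarrow> (\<integral>x. h x \<partial>std_gaussian)"
proof -
  have [measurable]: "h \<in> borel_measurable borel" using borel_measurable_integrable[OF h] by simp
  define C where "C = (2 * exp (pi\<^sup>2 / 8)) ^ DIM(real ^ 'n)"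
  have "(\<lambda>n. \<integral>x. (\<Prod>b\<in>Basis. squash_density (real (Suc n)) (x \<bullet> b)) * h x \<partial>std_gaussian) \<longlonglongrightarrow> (\<integral>x. h x \<partial>std_gaussian)"
  proof (rule integral_dominated_convergence[where w="\<lambda>x. C * \<bar>h x\<bar>"])
    show "integrable std_gaussian (\<lambda>x. C * \<bar>h x\<bar>)" using h by auto
    show "AE x in std_gaussian. (\<lambda>n. (\<Prod>b\<in>Basis. squash_density (real (Suc n)) (x \<bullet> b)) * h x) \<longlonglongrightarrow> h x"
    proof (rule AE_I2)
      fix x
      have "(\<lambda>n. (\<Prod>b\<in>Basis. squash_density (real (Suc n)) (x \<bullet> b)) * h x) \<longlonglongrightarrow> (\<Prod>b\<in>(Basis :: (real ^ 'n) set). 1) * h x"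
        by (intro tendsto_intros squash_density_tendsto)
      then show "(\<lambda>n. (\<Prod>b\<in>Basis. squash_density (real (Suc n)) (x \<bullet> b)) * h x) \<longlonglongrightarrow> h x" by simp
    qed
    fix n
    show "AE x in std_gaussian. norm ((\<Prod>b\<in>Basis. squash_density (real (Suc n)) (x \<bullet> b)) * h x) \<le> C * \<bar>h x\<bar>"
    proof (rule AE_I2)
      fix x :: "real ^ 'n"
      have "(\<Prod>b\<in>Basis. squash_density (real (Suc n)) (x \<bullet> b)) \<le> (\<Prod>b\<in>(Basis :: (real ^ 'n) set). 2 * exp (pi\<^sup>2 / 8))"
        by (intro prod_mono conjI squash_density_nonneg squash_density_bound) simp
      then have "\<bar>\<Prod>b\<in>Basis. squash_density (real (Suc n)) (x \<bullet> b)\<bar> \<le> C"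
        by (simp add: C_def prod_nonneg squash_density_nonneg)
      then show "norm ((\<Prod>b\<in>Basis. squash_density (real (Suc n)) (x \<bullet> b)) * h x) \<le> C * \<bar>h x\<bar>"
        by (simp add: abs_mult mult_right_mono)
    qed
  qed auto
  then show ?thesis by (simp add: integral_squash_vec)
qed

section \<open>Smooth functions composed with the contraction\<close>

lemma C11_pair_of_derivative:
  fixes v :: "real ^ 'n \<Rightarrow> real" and P :: "real ^ 'n \<Rightarrow> real ^ 'n"
  assumes v: "\<And>x. v x \<in> {a..b}" and d: "\<And>x. (v has_derivative (\<lambda>h. P x \<bullet> h)) (at x)"
    and B: "\<And>x. norm (P x) \<le> B" and C: "\<And>x y. norm (P y - P x) \<le> C * norm (y - x)"
  shows "C11_pair a b (max B C) v P"
proof -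
  have B0: "0 \<le> B" using B[of undefined] norm_ge_zero order_trans by blast
  have le: "B \<le> max B C" "C \<le> max B C" "0 \<le> max B C" using B0 by auto
  have inner_on: "onorm (\<lambda>h. q \<bullet> h) \<le> norm q" for q :: "real ^ 'n"
    by (rule onorm_le) (simp add: Cauchy_Schwarz_ineq2)
  have 1: "\<bar>v y - v x\<bar> \<le> max B C * norm (y - x)" for x y
  proof -
    have "norm (v y - v x) \<le> B * norm (y - x)"
      using d B inner_on by (intro differentiable_bound[OF convex_UNIV, where f'="\<lambda>x h. P x \<bullet> h"]) (auto intro: order_trans)
    also have "\<dots> \<le> max B C * norm (y - x)" using le by (intro mult_right_mono) auto
    finally show ?thesis by simp
  qed
  have 2: "norm (P y - P x) \<le> max B C * norm (y - x)" for x y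
    using C[of y x] mult_right_mono[OF le(2), of "norm (y - x)"] by simp
  have 3: "\<bar>v y - v x - P x \<bullet> (y - x)\<bar> \<le> max B C * (norm (y - x))\<^sup>2" for x y
  proof -
    \<comment> \<open>Subtracting the linear part leaves the derivative \<open>P z - P x\<close>, of
      norm at most \<open>max B C * norm (y - x)\<close> on the segment; the mean value inequality
      then yields the quadratic remainder.\<close>
    define w where "w z = v z - P x \<bullet> z" for z
    have dw: "(w has_derivative (\<lambda>h. (P z - P x) \<bullet> h)) (at z within closed_segment x y)" for z
      unfolding w_def inner_diff_left
      by (rule has_derivative_diff[OF has_derivative_at_withinI[OF d] bounded_linear_imp_has_derivative[OF bounded_linear_inner_right]])
    have "norm (w y - w x) \<le> (max B C * norm (y - x)) * norm (y - x)"
    proof (rule differentiable_bound[OF convex_closed_segment dw])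
      fix z assume "z \<in> closed_segment x y"
      then have "norm (z - x) \<le> norm (y - x)" by (metis norm_minus_commute segment_bound(1))
      then have "max B C * norm (z - x) \<le> max B C * norm (y - x)" using le by (intro mult_left_mono) auto
      then show "onorm (\<lambda>h. (P z - P x) \<bullet> h) \<le> max B C * norm (y - x)"
        using inner_on[of "P z - P x"] 2[of z x] by linarith
    qed auto
    then show ?thesis by (simp add: w_def inner_diff_right power2_eq_square algebra_simps)
  qed
  show ?thesis unfolding C11_pair_def using v order_trans[OF B le(1)] 1 2 3 by blast
qed

lemma smooth_gradient:
  fixes f :: "real ^ 'n \<Rightarrow> real"
  assumes "smooth f"
  shows "(f has_derivative (\<lambda>v. gradient f x \<bullet> v)) (at x)" "Ck_on (Suc 0) UNIV (\<lambda>x. gradient f x \<bullet> v)"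
proof -
  have "Ck_on (Suc (Suc 0)) UNIV f" using assms unfolding smooth_def by blast
  then obtain f' where f': "\<And>p. (f has_derivative f' p) (at p)" "\<And>v. Ck_on (Suc 0) UNIV (\<lambda>p. f' p v)"
    by (auto simp del: Ck_on.simps(1)) 
  have eq: "f' p v = gradient f p \<bullet> v" for p v
  proof -
    interpret linear "f' p" using f'(1) has_derivative_linear by blast
    have fd: "frechet_derivative f (at p) = f' p" using frechet_derivative_at[OF f'(1)] by simp
    have "f' p v = f' p (\<Sum>i\<in>UNIV. (v $ i) *\<^sub>R axis i 1)" by (simp add: basis_expansion scalar_mult_eq_scaleR[symmetric])
    also have "\<dots> = gradient f p \<bullet> v" by (simp add: sum scale gradient_def fd inner_vec_def mult.commute)
    finally show ?thesis .
  qed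
  show "(f has_derivative (\<lambda>v. gradient f x \<bullet> v)) (at x)" using f'(1)[of x] by (simp add: eq[symmetric])
  show "Ck_on (Suc 0) UNIV (\<lambda>x. gradient f x \<bullet> v)" using f'(2)[of v] by (simp only: eq)
qed

lemma Ck_on_1_continuous: "Ck_on (Suc 0) S g \<Longrightarrow> continuous_on S g"
  by (auto intro: has_derivative_continuous_on)

lemma smooth_continuous:
  fixes f :: "real ^ 'n \<Rightarrow> real"
  assumes "smooth f"
  shows "continuous_on UNIV f" "continuous_on UNIV (gradient f)"
proof -
  show "continuous_on UNIV f" using smooth_gradient(1)[OF assms] by (rule has_derivative_continuous_on[OF has_derivative_at_withinI])
  have "continuous_on UNIV (\<lambda>x. gradient f x \<bullet> b)" for b
    by (rule Ck_on_1_continuous[OF smooth_gradient(2)[OF assms]])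
  then show "continuous_on UNIV (gradient f)" by (rule continuous_on_componentwise[THEN iffD2, rule_format])
qed

text \<open>The gradient of \<open>f\<close> composed with \<open>squash_vec k\<close>: the Jacobian
  of \<open>squash_vec k\<close> is diagonal, so the chain rule rescales each component
  separately.\<close>

definition squash_gradient :: "real \<Rightarrow> (real ^ 'n \<Rightarrow> real) \<Rightarrow> real ^ 'n \<Rightarrow> real ^ 'n" where
  "squash_gradient k f x = vec_of (\<lambda>b. (gradient f (squash_vec k x) \<bullet> b) * (1 / (1 + (x \<bullet> b / k)\<^sup>2)))"

lemma squash_gradient_inner:
  "b \<in> Basis \<Longrightarrow> squash_gradient k f x \<bullet> b = (gradient f (squash_vec k x) \<bullet> b) * (1 / (1 + (x \<bullet> b / k)\<^sup>2))"
  unfolding squash_gradient_def by (rule vec_of_inner)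

lemma norm_squash_gradient_le:
  fixes x :: "real ^ 'n"
  shows "norm (squash_gradient k f x) \<le> norm (gradient f (squash_vec k x))"
proof (rule norm_le_componentwise)
  fix b :: "real ^ 'n" assume b: "b \<in> Basis"
  have "\<bar>1 / (1 + (x \<bullet> b / k)\<^sup>2)\<bar> \<le> 1" by (simp add: divide_le_eq add_nonneg_nonneg add_pos_nonneg)
  then show "\<bar>squash_gradient k f x \<bullet> b\<bar> \<le> \<bar>gradient f (squash_vec k x) \<bullet> b\<bar>"
    unfolding squash_gradient_inner[OF b] abs_mult by (intro mult_right_le_one_le) auto
qed

lemma squash_vec_has_derivative:
  fixes x :: "real ^ 'n"
  assumes "k > 0"
  shows "(squash_vec k has_derivative (\<lambda>h. vec_of (\<lambda>b. (h \<bullet> b) * (1 / (1 + (x \<bullet> b / k)\<^sup>2))))) (at x)"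
  unfolding squash_vec_def[abs_def]
proof (intro has_derivative_sum has_derivative_scaleR_left)
  fix b :: "real ^ 'n"
  have "((\<lambda>x. x \<bullet> b) has_derivative (\<lambda>h. h \<bullet> b)) (at x)"
    by (intro has_derivative_inner_left has_derivative_ident)
  from has_derivative_compose[OF this squash_has_derivative[OF assms, of "x \<bullet> b" UNIV, unfolded has_field_derivative_def]]
  show "((\<lambda>x. squash k (x \<bullet> b)) has_derivative (\<lambda>h. (h \<bullet> b) * (1 / (1 + (x \<bullet> b / k)\<^sup>2)))) (at x)"
    by (simp add: mult.commute)
qed

lemma squash_vec_lipschitz:
  assumes "k > 0"
  shows "norm (squash_vec k y - squash_vec k x) \<le> norm (y - x)"
  by (rule norm_le_componentwise) (simp add: inner_diff_left squash_vec_inner squash_lipschitz[OF assms])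

lemma inverse_quadratic_lipschitz: "\<bar>1 / (1 + u\<^sup>2) - 1 / (1 + w\<^sup>2)\<bar> \<le> \<bar>u - w :: real\<bar>"
proof -
  have "norm (1 / (1 + u\<^sup>2) - 1 / (1 + w\<^sup>2)) \<le> 1 * norm (u - w)"
  proof (rule field_differentiable_bound[OF convex_UNIV])
    fix t :: real
    have p: "1 + t\<^sup>2 > 0" by (simp add: add_pos_nonneg)
    show "((\<lambda>t. 1 / (1 + t\<^sup>2)) has_field_derivative (- (2 * t) / (1 + t\<^sup>2)\<^sup>2)) (at t within UNIV)"
      using p by (auto intro!: derivative_eq_intros simp: power2_eq_square)
    have "2 * \<bar>t\<bar> \<le> 1 + t\<^sup>2" using sum_squares_ge_zero[of "\<bar>t\<bar> - 1" 0] by (simp add: power2_eq_square algebra_simps)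
    also have "\<dots> \<le> (1 + t\<^sup>2)\<^sup>2" using self_le_power[of "1 + t\<^sup>2" 2] by simp
    finally show "norm (- (2 * t) / (1 + t\<^sup>2)\<^sup>2) \<le> 1" using p by (simp add: abs_mult)
  qed auto
  then show ?thesis by simp
qed

definition squash_box :: "real \<Rightarrow> (real ^ 'n) set" where
  "squash_box k = cbox (- (k * (pi / 2)) *\<^sub>R One) ((k * (pi / 2)) *\<^sub>R One)"

lemma squash_vec_in_box:
  fixes x :: "real ^ 'n"
  assumes k: "k > 0"
  shows "squash_vec k x \<in> squash_box k"
  unfolding squash_box_def mem_box
proof
  fix b :: "real ^ 'n" assume b: "b \<in> Basis"
  then show "- (k * (pi / 2)) *\<^sub>R One \<bullet> b \<le> squash_vec k x \<bullet> b \<and> squash_vec k x \<bullet> b \<le> (k * (pi / 2)) *\<^sub>R One \<bullet> b"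
    using squash_range[OF k, of "x \<bullet> b"] unfolding inner_scaleR_left inner_sum_Basis[OF b] squash_vec_inner[OF b]
    by (intro conjI; linarith)
qed

lemma gradient_bounded_on_squash_box:
  assumes "smooth f"
  shows "\<exists>B. \<forall>x\<in>squash_box k. norm (gradient f x) \<le> B"
proof -
  have "bounded (gradient f ` squash_box k)"
    unfolding squash_box_def by (intro compact_imp_bounded compact_continuous_image continuous_on_subset[OF smooth_continuous(2)[OF assms]]) auto
  then show ?thesis by (auto simp: bounded_iff)
qed

text \<open>The gradient of \<open>f\<close> is evaluated on the compact box
  \<open>squash_box k\<close> only, where it is bounded and Lipschitz. The factors from the chain
  rule are bounded by 1 and have Lipschitz constant \<open>1 / k\<close>, so the product rule for
  differences applies in each component.\<close>

lemma squash_C11_pair: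
  fixes f :: "real ^ 'n \<Rightarrow> real"
  assumes f: "smooth f" "\<And>x. f x \<in> {a..b}" and k: "k > 0"
  shows "\<exists>L. C11_pair a b L (\<lambda>x. f (squash_vec k x)) (squash_gradient k f)"
proof -
  let ?K = "squash_box k :: (real ^ 'n) set"
  note K = squash_vec_in_box[OF k]
  obtain B where B: "\<And>x. x \<in> ?K \<Longrightarrow> norm (gradient f x) \<le> B"
    using gradient_bounded_on_squash_box[OF f(1)] by blast
  have B0: "0 \<le> B" using B[OF K[of 0]] norm_ge_zero order_trans by blast
  have "\<forall>b. \<exists>C\<ge>0. \<forall>x\<in>?K. \<forall>y\<in>?K. \<bar>gradient f x \<bullet> b - gradient f y \<bullet> b\<bar> \<le> C * norm (x - y)"
    by (intro allI Ck_on_1_lipschitz[OF smooth_gradient(2)[OF f(1)]]) (auto simp: squash_box_def)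
  then obtain C where C: "\<And>b. 0 \<le> C b" "\<And>b x y. x \<in> ?K \<Longrightarrow> y \<in> ?K \<Longrightarrow> \<bar>gradient f x \<bullet> b - gradient f y \<bullet> b\<bar> \<le> C b * norm (x - y)"
    by metis
  have lip: "norm (squash_gradient k f y - squash_gradient k f x) \<le> (\<Sum>b\<in>Basis. C b + B / k) * norm (y - x)" for x y
  proof -
    have "norm (squash_gradient k f y - squash_gradient k f x) \<le> (\<Sum>b\<in>Basis. \<bar>(squash_gradient k f y - squash_gradient k f x) \<bullet> b\<bar>)"
      by (rule norm_le_l1)
    also have "\<dots> \<le> (\<Sum>b\<in>Basis. (C b + B / k) * norm (y - x))"
    proof (rule sum_mono)
      fix b :: "real ^ 'n" assume b: "b \<in> Basis"
      define g where "g z = gradient f (squash_vec k z) \<bullet> b" for z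
      define s where "s z = 1 / (1 + (z \<bullet> b / k)\<^sup>2)" for z
      have s1: "\<bar>s y\<bar> \<le> 1" by (simp add: s_def divide_le_eq add_nonneg_nonneg add_pos_nonneg)
      have "\<bar>s y - s x\<bar> \<le> \<bar>y \<bullet> b / k - x \<bullet> b / k\<bar>" unfolding s_def by (rule inverse_quadratic_lipschitz)
      also have "\<dots> = \<bar>(y - x) \<bullet> b\<bar> / k" using k by (simp add: inner_diff_left diff_divide_distrib[symmetric])
      also have "\<dots> \<le> norm (y - x) / k" using k b by (intro divide_right_mono Basis_le_norm) auto
      finally have s2: "\<bar>s y - s x\<bar> \<le> norm (y - x) / k" .
      have "\<bar>g y - g x\<bar> \<le> C b * norm (squash_vec k y - squash_vec k x)" unfolding g_def by (intro C K)
      also have "\<dots> \<le> C b * norm (y - x)" by (intro mult_left_mono squash_vec_lipschitz[OF k] C(1))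
      finally have g2: "\<bar>g y - g x\<bar> \<le> C b * norm (y - x)" .
      have g1: "\<bar>g x\<bar> \<le> B" unfolding g_def using B[OF K[of x]] Basis_le_norm[OF b] order_trans by blast
      have "\<bar>(squash_gradient k f y - squash_gradient k f x) \<bullet> b\<bar> = \<bar>(g y - g x) * s y + g x * (s y - s x)\<bar>"
        by (simp add: inner_diff_left squash_gradient_inner[OF b] g_def[symmetric] s_def[symmetric] algebra_simps)
      also have "\<dots> \<le> \<bar>g y - g x\<bar> * \<bar>s y\<bar> + \<bar>g x\<bar> * \<bar>s y - s x\<bar>"
        by (metis abs_mult abs_triangle_ineq)
      also have "\<dots> \<le> (C b * norm (y - x)) * 1 + B * (norm (y - x) / k)"
        using s1 s2 g1 g2 C(1) B0 by (intro add_mono mult_mono) auto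
      finally show "\<bar>(squash_gradient k f y - squash_gradient k f x) \<bullet> b\<bar> \<le> (C b + B / k) * norm (y - x)"
        by (simp add: algebra_simps)
    qed
    finally show ?thesis by (simp add: sum_distrib_right)
  qed
  have bnd: "norm (squash_gradient k f x) \<le> B" for x
    using norm_squash_gradient_le B[OF K] order_trans by blast
  have der: "((\<lambda>x. f (squash_vec k x)) has_derivative (\<lambda>h. squash_gradient k f x \<bullet> h)) (at x)" for x
  proof (rule has_derivative_eq_rhs[OF has_derivative_compose[OF squash_vec_has_derivative[OF k] smooth_gradient(1)[OF f(1)]]], rule ext)
    fix h
    show "gradient f (squash_vec k x) \<bullet> vec_of (\<lambda>b. (h \<bullet> b) * (1 / (1 + (x \<bullet> b / k)\<^sup>2))) = squash_gradient k f x \<bullet> h"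
      by (simp add: squash_gradient_def inner_sum_right inner_sum_left inner_commute mult_ac)
  qed
  show ?thesis using C11_pair_of_derivative[OF f(2) der bnd lip] by blast
qed

section \<open>Passage to the limit for smooth functions\<close>

context concave_profile
begin

lemma gaussian_inequality_integrable:
  fixes f :: "real ^ 'n \<Rightarrow> real"
  assumes f: "smooth f" "\<And>x. f x \<in> {a..b}"
    and h: "integrable std_gaussian (\<lambda>x. N (f x, (norm (gradient f x))\<^sup>2))"
  shows "(\<integral>x. N (f x, (norm (gradient f x))\<^sup>2) \<partial>std_gaussian) \<le> N (\<integral>x. f x \<partial>std_gaussian, 0)"
proof -
  let ?h = "\<lambda>x. N (f x, (norm (gradient f x))\<^sup>2)"
  have fm: "f \<in> borel_measurable borel" using smooth_continuous(1)[OF f(1)] by (rule borel_measurable_continuous_onI)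
  have "\<bar>f x\<bar> \<le> \<bar>a\<bar> + \<bar>b\<bar>" for x
  proof -
    have "a \<le> f x" "f x \<le> b" using f(2)[of x] by auto
    then show ?thesis by linarith
  qed
  then have fI: "integrable std_gaussian f"
    by (intro integrable_std_gaussian_bounded[OF fm, where B="\<bar>a\<bar> + \<bar>b\<bar>"]) simp
  have step: "(\<integral>x. ?h (squash_vec (real (Suc n)) x) \<partial>std_gaussian) \<le> N (\<integral>x. f (squash_vec (real (Suc n)) x) \<partial>std_gaussian, 0)"
    and mem: "(\<integral>x. f (squash_vec (real (Suc n)) x) \<partial>(std_gaussian :: (real ^ 'n) measure)) \<in> {a..b}" for n
  proof -
    let ?k = "real (Suc n)"
    have k: "?k > 0" by simp
    obtain L where A: "C11_pair a b L (\<lambda>x. f (squash_vec ?k x)) (squash_gradient ?k f)"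
      using squash_C11_pair[OF f k] by blast
    have I: "integrable std_gaussian (\<lambda>x. N (f (squash_vec ?k x), (norm (squash_gradient ?k f x))\<^sup>2))"
    proof -
      obtain B where "\<And>x. norm (N (f (squash_vec ?k x), 1 * (norm (squash_gradient ?k f x))\<^sup>2)) \<le> B"
        using C11_pair_compose(1)[OF A, of 1] by auto
      then show ?thesis
        using C11_pair_compose(2)[OF A, of 1] by (intro integrable_std_gaussian_bounded[where B=B]) auto
    qed
    \<comment> \<open>The contraction enters here: the gradient of the composition is no longer than
      \<open>gradient f\<close> at the image point, and \<open>N\<close> decreases in its second
      argument.\<close>
    have le: "?h (squash_vec ?k x) \<le> N (f (squash_vec ?k x), (norm (squash_gradient ?k f x))\<^sup>2)" for x
      using f(2) by (intro N_antimono power_mono norm_squash_gradient_le) auto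
    have "(\<integral>x. ?h (squash_vec ?k x) \<partial>std_gaussian) \<le> (\<integral>x. N (f (squash_vec ?k x), (norm (squash_gradient ?k f x))\<^sup>2) \<partial>std_gaussian)"
    proof (rule integral_mono[OF _ I le])
      show "integrable std_gaussian (\<lambda>x. ?h (squash_vec ?k x))"
      proof -
        obtain B where B: "\<And>x. x \<in> squash_box ?k \<Longrightarrow> norm (gradient f x) \<le> B"
          using gradient_bounded_on_squash_box[OF f(1)] by blast
        obtain B' where B': "\<And>p. p \<in> {a..b} \<times> {0..B\<^sup>2} \<Longrightarrow> \<bar>N p\<bar> \<le> B'" using bounded_N by blast
        have "norm (?h (squash_vec ?k x)) \<le> B'" for x
          using f(2) B[OF squash_vec_in_box[OF k]] by (auto intro!: B' power_mono)
        then show ?thesis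
          using borel_measurable_integrable[OF h]
          by (intro integrable_std_gaussian_bounded[where B=B'] measurable_compose[OF squash_vec_measurable, of ?h]) auto
      qed
    qed
    also have "\<dots> \<le> N (\<integral>x. f (squash_vec ?k x) \<partial>std_gaussian, 0)"
      by (rule gaussian_inequality_C11[OF A])
    finally show "(\<integral>x. ?h (squash_vec ?k x) \<partial>std_gaussian) \<le> N (\<integral>x. f (squash_vec ?k x) \<partial>std_gaussian, 0)" .
    show "(\<integral>x. f (squash_vec ?k x) \<partial>std_gaussian) \<in> {a..b}"
      using C11_pair_integrable(1)[OF A, of 0 1] f(2) by (intro integral_std_gaussian_mem_Icc) auto
  qed
  have lim_f: "(\<lambda>n. \<integral>x. f (squash_vec (real (Suc n)) x) \<partial>std_gaussian) \<longlonglongrightarrow> (\<integral>x. f x \<partial>std_gaussian)"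
    by (rule integral_squash_vec_tendsto[OF fI])
  have "(\<integral>x. f x \<partial>std_gaussian) \<in> {a..b}" using fI f(2) by (rule integral_std_gaussian_mem_Icc)
  moreover have "continuous_on {a..b} (\<lambda>x. N (x, 0))"
    by (intro continuous_on_compose2[OF continuous_N] continuous_intros) auto
  ultimately have "(\<lambda>n. N (\<integral>x. f (squash_vec (real (Suc n)) x) \<partial>std_gaussian, 0)) \<longlonglongrightarrow> N (\<integral>x. f x \<partial>std_gaussian, 0)"
    using lim_f mem by (intro continuous_on_tendsto_compose[where f="\<lambda>x. N (x, 0)"]) auto
  then show ?thesis
    by (rule LIMSEQ_le[OF integral_squash_vec_tendsto[OF h]]) (use step in auto)
qed

end

text \<open>The upper bound makes the integral of the positive part finite. If \<open>g\<close> is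
  not integrable, the negative part has infinite integral and the value is
  \<open>- \<infinity>\<close>; so the inequality has content for integrable \<open>g\<close>
  only.\<close>

lemma ereal_integral_le_of_bounded_above:
  assumes m: "g \<in> borel_measurable \<mu>" and fin: "finite_measure \<mu>" and C: "\<And>x. g x \<le> C"
    and le: "integrable \<mu> g \<Longrightarrow> integral\<^sup>L \<mu> g \<le> c"
  shows "ereal_integral \<mu> g \<le> ereal c"
proof (cases "integrable \<mu> g")
  case True
  then show ?thesis using le by (simp add: ereal_integral_eq_integral)
next
  case False
  interpret finite_measure \<mu> by fact
  have "(\<integral>\<^sup>+x. ennreal (g x) \<partial>\<mu>) \<le> (\<integral>\<^sup>+x. ennreal \<bar>C\<bar> \<partial>\<mu>)"
  proof (rule nn_integral_mono)
    show "ennreal (g x) \<le> ennreal \<bar>C\<bar>" for x using C[of x] by (intro ennreal_leI) linarith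
  qed
  also have "\<dots> < \<infinity>" using emeasure_finite by (simp add: ennreal_mult_eq_top_iff less_top[symmetric])
  finally have p: "(\<integral>\<^sup>+x. ennreal (g x) \<partial>\<mu>) \<noteq> \<infinity>" by simp
  then have n: "(\<integral>\<^sup>+x. ennreal (- g x) \<partial>\<mu>) = \<infinity>" using False m by (auto simp: real_integrable_def)
  show ?thesis using p unfolding ereal_integral_def n
    by (cases "\<integral>\<^sup>+x. ennreal (g x) \<partial>\<mu>") (auto simp: enn2ereal_ennreal)
qed

lemma gradient_constant: "(\<And>x. f x = c) \<Longrightarrow> gradient f x = 0"
proof -
  assume "\<And>x. f x = c"
  then have "f = (\<lambda>_. c)" by auto
  then show ?thesis by (simp add: gradient_def vec_eq_iff)
qed

theorem theorem1:
  fixes a b :: real and \<Omega> :: "real set"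
    and M :: "real \<Rightarrow> real \<Rightarrow> real"
    and f :: "real ^ 'n \<Rightarrow> real"
  assumes "a \<le> b" and "\<Omega> = {a..b}"
    and "Ck_on 2 (\<Omega> \<times> {0..}) (\<lambda>(x, y). M x (sqrt y))"
    and "\<And>x y. x \<in> \<Omega> \<Longrightarrow> y > 0 \<Longrightarrow> negative_semidefinite (M_matrix \<Omega> M x y)"
    and "smooth f" and "\<And>x. f x \<in> \<Omega>"
  shows "ereal_integral std_gaussian (\<lambda>x. M (f x) (norm (gradient f x)))
           \<le> ereal (M (\<integral>x. f x \<partial>std_gaussian) 0)"
proof (cases "a = b")
  \<comment> \<open>On a one-point interval derivatives within the set are not unique; but
    \<open>f\<close> is constant there, and both sides equal \<open>M a 0\<close>.\<close>
  case True
  then have c: "f x = a" for x using assms(2) assms(6)[of x] by auto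
  then have "gradient f x = 0" for x by (rule gradient_constant)
  then show ?thesis
    by (simp add: c ereal_integral_eq_integral)
next
  case False
  define N where "N = (\<lambda>(x, y). M x (sqrt y))"
  have "a < b" using False assms(1) by simp
  then obtain Nx Nz Nxx Nxz Nzz where "concave_profile a b N Nx Nz Nxx Nxz Nzz"
    using concave_profile_of_M_matrix[of a b M] assms(3,4) unfolding assms(2) N_def by blast
  then interpret concave_profile a b N Nx Nz Nxx Nxz Nzz .
  have f: "f x \<in> {a..b}" for x using assms(2,6) by simp
  have MN: "M (f x) (norm (gradient f x)) = N (f x, (norm (gradient f x))\<^sup>2)" for x by (simp add: N_def)
  \<comment> \<open>Since \<open>N\<close> decreases in its second argument, a bound on the compact
    segment \<open>z = 0\<close> bounds the integrand from above.\<close>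
  obtain C where C: "\<And>p. p \<in> {a..b} \<times> {0..0} \<Longrightarrow> \<bar>N p\<bar> \<le> C" using bounded_N by blast
  have "ereal_integral std_gaussian (\<lambda>x. N (f x, (norm (gradient f x))\<^sup>2)) \<le> ereal (N (\<integral>x. f x \<partial>std_gaussian, 0))"
  proof (rule ereal_integral_le_of_bounded_above)
    have "continuous_on UNIV (\<lambda>x. N (f x, (norm (gradient f x))\<^sup>2))"
      using f smooth_continuous[OF assms(5)]
      by (intro continuous_on_compose2[OF continuous_N] continuous_intros) auto
    then show "(\<lambda>x. N (f x, (norm (gradient f x))\<^sup>2)) \<in> borel_measurable std_gaussian"
      unfolding measurable_cong_sets[OF sets_std_gaussian refl] by (rule borel_measurable_continuous_onI)
    show "finite_measure (std_gaussian :: (real ^ 'n) measure)" by unfold_locales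
    show "N (f x, (norm (gradient f x))\<^sup>2) \<le> C" for x
      using N_antimono[OF f[of x], of 0 "(norm (gradient f x))\<^sup>2"] C[of "(f x, 0)"] f[of x] by simp
  qed (rule gaussian_inequality_integrable[OF assms(5) f])
  then show ?thesis by (simp add: MN) (simp add: N_def)
qed

end
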